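(* Let $\delta>0$ and suppose $\lim_kr_k=r\in[0,1]$. (a) If $r<1$, then $(\log n)^{-1/2}\big(N_n-\theta(m(n))\big)\xrightarrow{D}N(0,\sigma_r^2)$, where $\sigma_0^2=1$ and, for $r\ne0$, $\sigma_r^2=-r(1-r)^\delta\big((1-r)^{\delta+1}-(1+2\delta r)(1-r)^\delta+1\big)/\log(1-r)$. (b) If $r=1$, define $e_k=(1-r_k)(1-r_{k+1})\cdots(1-r_{k+\delta-1})$. If $\sum_{k=0}^\infty e_k=\infty$, then $$\frac{N_n-\theta(m(n))}{\sqrt{\sum_{k=0}^{m(n)}e_k}}\xrightarrow{D}N(0,1),$$ and if $\sum_{k=0}^\infty e_k<\infty$, then $\lim_nN_n<\infty$ almost surely.
   Context: Let $\{X_n,n\ge1\}$ be independent, identically distributed random variables with values in $\mathbb{Z}_+=\{0,1,2,\dots\}$ such that $p_k=P[X_1=k]>0$ for every $k\in\mathbb{Z}_+$ (set $p_m=0$ for integers $m\le -1$). For $k\in\mathbb{Z}_+$ let $y_k=\sum_{i>k}p_i$, and set $y_m=1$ for integers $m\le-1$. Let $r_k=p_k/y_{k-1}$, $k\in\mathbb{Z}_+$, and $m(t)=\min\{j\in\mathbb{Z}_+: y_j<1/t\}$ for $t>0$. For the fixed integer $\delta$ define $s_k=p_{k+\delta}/y_{k-1}$ and $\theta(k)=\sum_{i=0}^k s_i$ for $k\in\mathbb{Z}_+$. Let $M_0=0$ and $M_n=\max\{X_1,\dots,X_n\}$ for $n\ge1$, and let $N_n=\sum_{k=1}^n\mathbf{1}_{\{X_k>M_{k-1}+\delta\}}$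 be the number of $\delta$-records among the first $n$ observations. $N(0,\sigma^2)$ denotes the centered normal law with variance $\sigma^2$ and $\xrightarrow{D}$ convergence in distribution as $n\to\infty$. *)

theory Defs
  imports "HOL-Probability.Probability"
begin

definition ytail :: "(nat \<Rightarrow> real) \<Rightarrow> nat \<Rightarrow> real" where
  "ytail p k = (\<Sum>i. p (i + k + 1))"

definition yprev :: "(nat \<Rightarrow> real) \<Rightarrow> nat \<Rightarrow> real" where
  "yprev p k = (if k = 0 then 1 else ytail p (k - 1))"

definition rk :: "(nat \<Rightarrow> real) \<Rightarrow> nat \<Rightarrow> real" where
  "rk p k = p k / yprev p k"

definition sk :: "(nat \<Rightarrow> real) \<Rightarrow> nat \<Rightarrow> nat \<Rightarrow> real" where
  "sk p \<delta> k = p (k + \<delta>) / yprev p k"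

definition theta :: "(nat \<Rightarrow> real) \<Rightarrow> nat \<Rightarrow> nat \<Rightarrow> real" where
  "theta p \<delta> k = (\<Sum>i\<le>k. sk p \<delta> i)"

definition mt :: "(nat \<Rightarrow> real) \<Rightarrow> real \<Rightarrow> nat" where
  "mt p t = (LEAST j. ytail p j < 1 / t)"

definition runmax :: "(nat \<Rightarrow> 'a \<Rightarrow> nat) \<Rightarrow> nat \<Rightarrow> 'a \<Rightarrow> nat" where
  "runmax X n \<omega> = Max (insert 0 ((\<lambda>k. X k \<omega>) ` {1..n}))"

definition Nrec :: "(nat \<Rightarrow> 'a \<Rightarrow> nat) \<Rightarrow> nat \<Rightarrow> nat \<Rightarrow> 'a \<Rightarrow> nat" where
  "Nrec X \<delta> n \<omega> = card {k \<in> {1..n}. X k \<omega> > runmax X (k - 1) \<omega> + \<delta>}"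

definition ek :: "(nat \<Rightarrow> real) \<Rightarrow> nat \<Rightarrow> nat \<Rightarrow> real" where
  "ek p \<delta> k = (\<Prod>j\<in>{k..<k + \<delta>}. 1 - rk p j)"

definition sigma_sq :: "real \<Rightarrow> nat \<Rightarrow> real" where
  "sigma_sq r \<delta> = (if r = 0 then 1 else
     - r * (1 - r) ^ \<delta> * ((1 - r) ^ (\<delta> + 1) - (1 + 2 * real \<delta> * r) * (1 - r) ^ \<delta> + 1)
       / ln (1 - r))"

definition normal_dist :: "real \<Rightarrow> real measure" where
  "normal_dist v = (if v > 0 then density lborel (normal_density 0 (sqrt v))
                    else return lborel 0)"

end

theory Submission
  imports Defs
begin

text \<open>
  For \<open>\<delta> > 0\<close> the \<open>\<delta>\<close>-records are counted by value instead of by time: if \<open>D m\<close> is the number of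
  \<open>\<delta>\<close>-record values at most \<open>m\<close>, then \<open>N n = D (M n)\<close>. A \<open>\<delta>\<close>-record value \<open>k\<close> excludes record
  values in \<open>k - \<delta>, \<dots>, k - 1\<close>, and whether \<open>k\<close> is one depends only on the first observation
  \<open>\<ge> k - \<delta>\<close>, which is independent of \<open>D (k - \<delta> - 1)\<close>. Hence the characteristic functions
  \<open>\<phi> k = E (exp (\<i> u D k))\<close> satisfy the exact linear recursion
  \<open>\<phi> k = \<phi> (k - 1) + (exp (\<i> u) - 1) s (k - \<delta>) \<phi> (k - \<delta> - 1)\<close>, whose expansion for small \<open>u\<close> is
  Gaussian with mean \<open>\<Sum> s\<close> and variance asymptotic to \<open>(1 - (2\<delta> + 1) r (1 - r)^\<delta>) \<Sum> s\<close>.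
  Since \<open>M n\<close> lies with high probability between \<open>m (n / K)\<close> and \<open>m (n K)\<close>, a window expected to
  contain at most \<open>1 + 2 ln K\<close> record values, \<open>D (M n)\<close> may be replaced by \<open>D (m n)\<close>, and the
  result follows from Levy's continuity theorem. If \<open>\<Sum> e\<close> converges, the
  Borel-Cantelli lemma leaves only finitely many record values.
\<close>

section \<open>Weighted averages and delayed linear recursions\<close>

text \<open>The finitely many early terms contribute a fixed amount, which a divergent total weight
  makes negligible, and every later ratio is close to \<open>c\<close>. This serves both for the
  variance of the record count and for comparing \<open>theta\<close> with explicit norming
  sums.\<close>

lemma weighted_cesaro:
  fixes l q :: "nat \<Rightarrow> real"
  assumes nonneg: "\<And>k. 0 \<le> l k"
    and diverges: "filterlim (\<lambda>n. \<Sum>k<n. l k) at_top sequentially"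
    and lim: "q \<longlonglongrightarrow> c"
  shows "(\<lambda>n. (\<Sum>k<n. q k * l k) / (\<Sum>k<n. l k)) \<longlonglongrightarrow> c"
proof (rule LIMSEQ_I)
  fix e :: real assume e: "0 < e"
  obtain N where N: "\<And>k. k \<ge> N \<Longrightarrow> \<bar>q k - c\<bar> < e / 2"
    using LIMSEQ_D[OF lim, of "e / 2"] e by auto
  \<comment> \<open>\<open>C\<close> bounds the contribution of the initial segment. The threshold
    \<open>2 * C / e + 1\<close> below makes the total weight \<open>L\<close> positive and gives
    \<open>C < e / 2 * L\<close>.\<close>
  define C where "C = (\<Sum>k<N. \<bar>q k - c\<bar> * l k)"
  have C: "0 \<le> C" unfolding C_def by (intro sum_nonneg mult_nonneg_nonneg nonneg) auto
  have "\<forall>\<^sub>F n in sequentially. (\<Sum>k<n. l k) > 2 * C / e + 1"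
    using diverges by (auto simp: filterlim_at_top_dense)
  then obtain N' where N': "\<And>n. n \<ge> N' \<Longrightarrow> (\<Sum>k<n. l k) > 2 * C / e + 1"
    by (auto simp: eventually_sequentially)
  show "\<exists>no. \<forall>n\<ge>no. norm ((\<Sum>k<n. q k * l k) / (\<Sum>k<n. l k) - c) < e"
  proof (intro exI allI impI)
    fix n assume n: "n \<ge> max N N'"
    define L where "L = (\<Sum>k<n. l k)"
    have L: "L > 2 * C / e + 1" using N' n unfolding L_def by simp
    have "0 \<le> 2 * C / e" using C e by simp
    with L have Lpos: "L > 0" by linarith
    have LC: "C < e / 2 * L"
    proof -
      have "2 * C / e < L" using L by linarith
      then show ?thesis using e by (simp add: field_simps)
    qed
    have "(\<Sum>k<n. q k * l k) / L - c = (\<Sum>k<n. (q k - c) * l k) / L"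
      using Lpos by (simp add: L_def field_simps sum_subtractf sum_distrib_left)
    moreover have "\<bar>\<Sum>k<n. (q k - c) * l k\<bar> \<le> C + e / 2 * L"
    proof -
      have "\<bar>\<Sum>k<n. (q k - c) * l k\<bar> \<le> (\<Sum>k<n. \<bar>q k - c\<bar> * l k)"
        using sum_abs[of "\<lambda>k. (q k - c) * l k" "{..<n}"] nonneg by (simp add: abs_mult)
      also have "\<dots> = C + (\<Sum>k\<in>{N..<n}. \<bar>q k - c\<bar> * l k)"
        using n by (simp add: C_def sum.atLeastLessThan_concat flip: atLeast0LessThan)
      also have "(\<Sum>k\<in>{N..<n}. \<bar>q k - c\<bar> * l k) \<le> (\<Sum>k\<in>{N..<n}. e / 2 * l k)"
        using N by (intro sum_mono mult_right_mono nonneg less_imp_le) auto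
      also have "\<dots> \<le> (\<Sum>k<n. e / 2 * l k)"
        using nonneg e by (intro sum_mono2) auto
      also have "\<dots> = e / 2 * L" by (simp add: L_def sum_distrib_left)
      finally show ?thesis by simp
    qed
    moreover have "C + e / 2 * L < e * L" using LC by linarith
    ultimately have "\<bar>(\<Sum>k<n. q k * l k) / L - c\<bar> < e"
      using Lpos by (simp add: field_simps)
    then show "norm ((\<Sum>k<n. q k * l k) / (\<Sum>k<n. l k) - c) < e"
      by (simp add: L_def)
  qed
qed

section \<open>Gaussian expansion of a delayed linear recursion\<close>

lemma norm_iexp_minus_one_le: "norm (iexp u - 1) \<le> \<bar>u\<bar>"
  using iexp_approx1[of u 0] by simp

text \<open>The exponent \<open>w\<close> is chosen so that both sides agree up to order
  \<open>u\<^sup>2\<close>: the term \<open>- x\<close> in the variance compensates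
  \<open>w\<^sup>2 / 2\<close>, and \<open>- 2 * b\<close> accounts for the delay. The factor
  \<open>x\<close> is retained in the error so that summing over steps gives a multiple of
  \<open>\<bar>u\<bar> ^ 3\<close> times the sum of the \<open>x i\<close>.\<close>

lemma one_step_multiplier_bound:
  fixes u x b d :: real
  assumes u: "\<bar>u\<bar> \<le> 1" and x: "0 \<le> x" "x \<le> 1" and b: "0 \<le> b" "b \<le> d"
  defines "z \<equiv> iexp u - 1"
  defines "w \<equiv> \<i> * of_real (u * x) - of_real (u\<^sup>2 * (x * (1 - x - 2 * b)) / 2)"
  shows "norm (1 + z * of_real x - z\<^sup>2 * of_real (x * b) - exp w)
    \<le> (1 + d + (1 + d) * (3 + d) + (2 + d) ^ 3 * exp (2 + d)) * (\<bar>u\<bar> ^ 3 * x)"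
proof -
  \<comment> \<open>The quantities \<open>e1\<close> to \<open>e4\<close> are the Taylor remainders
    of \<open>z\<close>, \<open>z\<^sup>2\<close>, \<open>w\<^sup>2\<close> and
    \<open>exp w\<close>, each of third order in \<open>u\<close>.\<close>
  define e1 where "e1 = z - \<i> * of_real u + of_real (u\<^sup>2 / 2)"
  define e2 where "e2 = z\<^sup>2 + of_real (u\<^sup>2)"
  define e3 where "e3 = w\<^sup>2 + of_real (u\<^sup>2 * x\<^sup>2)"
  define e4 where "e4 = exp w - 1 - w - w\<^sup>2 / 2"
  have d: "0 \<le> d" using b by simp
  have z1: "norm z \<le> \<bar>u\<bar>" unfolding z_def by (rule norm_iexp_minus_one_le)
  have e1: "norm e1 \<le> \<bar>u\<bar> ^ 3"
  proof -
    have "norm e1 \<le> \<bar>u\<bar> ^ 3 / 6"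
      using iexp_approx1[of u 2]
      by (simp add: e1_def z_def numeral_eq_Suc power_mult_distrib algebra_simps)
    also have "\<dots> \<le> \<bar>u\<bar> ^ 3" by simp
    finally show ?thesis .
  qed
  have e2: "norm e2 \<le> \<bar>u\<bar> ^ 3"
  proof -
    \<comment> \<open>The difference of squares splits into a factor of second order and one of
      first order; the same device is applied to \<open>e3\<close>.\<close>
    have fac: "e2 = (z - \<i> * of_real u) * (z + \<i> * of_real u)"
      by (simp add: e2_def algebra_simps power2_eq_square)
    moreover have "norm (z - \<i> * of_real u) \<le> \<bar>u\<bar>\<^sup>2 / 2"
      using iexp_approx1[of u 1] by (simp add: z_def numeral_eq_Suc algebra_simps)
    moreover have "norm (z + \<i> * of_real u) \<le> 2 * \<bar>u\<bar>"
      using norm_triangle_ineq[of z "\<i> * of_real u"] z1 by (simp add: norm_mult)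
    ultimately have "norm e2 \<le> (\<bar>u\<bar>\<^sup>2 / 2) * (2 * \<bar>u\<bar>)"
      unfolding fac norm_mult by (intro mult_mono) auto
    then show ?thesis by (simp add: power2_eq_square power3_eq_cube)
  qed
  have quad: "norm (w - \<i> * of_real (u * x)) \<le> \<bar>u\<bar>\<^sup>2 * x * (1 + d)"
  proof -
    have "\<bar>1 - x - 2 * b\<bar> \<le> 2 * (1 + d)" using x b d by (simp add: abs_le_iff)
    then have "u\<^sup>2 * x * \<bar>1 - x - 2 * b\<bar> \<le> u\<^sup>2 * x * (2 * (1 + d))"
      using x by (intro mult_left_mono) auto
    moreover have "w - \<i> * of_real (u * x) = - of_real (u\<^sup>2 * (x * (1 - x - 2 * b)) / 2)"
      by (simp add: w_def)
    then have "norm (w - \<i> * of_real (u * x)) = u\<^sup>2 * x * \<bar>1 - x - 2 * b\<bar> / 2"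
      using x by (simp only: norm_minus_cancel norm_of_real) (simp add: abs_mult)
    ultimately show ?thesis by (simp add: algebra_simps)
  qed
  have uu: "\<bar>u\<bar>\<^sup>2 \<le> \<bar>u\<bar>" using power_decreasing[of 1 2 "\<bar>u\<bar>"] u by simp
  have quad': "norm (w - \<i> * of_real (u * x)) \<le> \<bar>u\<bar> * x * (1 + d)"
    using quad mult_right_mono[OF uu, of "x * (1 + d)"] x d by (simp add: mult.assoc)
  have w: "norm w \<le> \<bar>u\<bar> * x * (2 + d)"
    using norm_triangle_ineq[of "w - \<i> * of_real (u * x)" "\<i> * of_real (u * x)"] quad' x
    by (simp add: norm_mult abs_mult algebra_simps)
  have e3: "norm e3 \<le> (1 + d) * (3 + d) * (\<bar>u\<bar> ^ 3 * x)"
  proof -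
    have fac: "e3 = (w - \<i> * of_real (u * x)) * (w + \<i> * of_real (u * x))"
      by (simp add: e3_def algebra_simps power2_eq_square)
    moreover have "norm (w + \<i> * of_real (u * x)) \<le> \<bar>u\<bar> * (3 + d)"
    proof -
      have "norm (w + \<i> * of_real (u * x)) \<le> \<bar>u\<bar> * x * (2 + d) + \<bar>u\<bar> * x"
        using norm_triangle_ineq[of w "\<i> * of_real (u * x)"] w x
        by (simp add: norm_mult abs_mult)
      also have "\<dots> = \<bar>u\<bar> * x * (3 + d)" by (simp add: algebra_simps)
      also have "\<dots> \<le> \<bar>u\<bar> * (3 + d)"
        using x d by (intro mult_right_mono) (auto simp: mult_left_le)
      finally show ?thesis .
    qed
    ultimately have "norm e3 \<le> (\<bar>u\<bar>\<^sup>2 * x * (1 + d)) * (\<bar>u\<bar> * (3 + d))"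
      unfolding fac norm_mult using quad x d by (intro mult_mono) auto
    then show ?thesis by (simp add: power2_eq_square power3_eq_cube algebra_simps)
  qed
  have e4: "norm e4 \<le> (2 + d) ^ 3 * exp (2 + d) * (\<bar>u\<bar> ^ 3 * x)"
  proof -
    have "norm e4 \<le> exp \<bar>Re w\<bar> * norm w ^ 3 / 2"
      using Taylor_exp[of w 2] by (simp add: e4_def numeral_eq_Suc algebra_simps)
    also have "\<dots> \<le> exp \<bar>Re w\<bar> * norm w ^ 3" by simp
    also have "\<dots> \<le> exp (2 + d) * (\<bar>u\<bar> * x * (2 + d)) ^ 3"
    proof (intro mult_mono power_mono w)
      have "\<bar>Re w\<bar> \<le> norm w" by (rule abs_Re_le_cmod)
      also have "\<dots> \<le> 1 * 1 * (2 + d)"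
        by (rule order_trans[OF w]) (use u x d in \<open>intro mult_mono; simp\<close>)
      finally show "exp \<bar>Re w\<bar> \<le> exp (2 + d)" by simp
    qed auto
    also have "\<dots> = (2 + d) ^ 3 * exp (2 + d) * (\<bar>u\<bar> ^ 3 * x ^ 3)"
      by (simp only: power_mult_distrib mult_ac)
    also have "\<dots> \<le> (2 + d) ^ 3 * exp (2 + d) * (\<bar>u\<bar> ^ 3 * x)"
      using x d power_decreasing[of 1 3 x] by (intro mult_left_mono) auto
    finally show ?thesis .
  qed
  \<comment> \<open>All terms of order at most two cancel by the definition of \<open>w\<close>, so
    only the four remainders survive.\<close>
  have "1 + z * of_real x - z\<^sup>2 * of_real (x * b) - exp w
      = of_real x * e1 - of_real (x * b) * e2 - e3 / 2 - e4"
    unfolding e1_def e2_def e3_def e4_def by (simp add: w_def field_simps power2_eq_square)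
  also have "norm \<dots> \<le> norm (of_real x * e1) + norm (of_real (x * b) * e2) + norm (e3 / 2) + norm e4"
    by (intro order_trans[OF norm_triangle_ineq4] add_right_mono order_refl)
  also have "\<dots> \<le> x * \<bar>u\<bar> ^ 3 + x * d * \<bar>u\<bar> ^ 3 + (1 + d) * (3 + d) * (\<bar>u\<bar> ^ 3 * x)
      + (2 + d) ^ 3 * exp (2 + d) * (\<bar>u\<bar> ^ 3 * x)"
  proof (intro add_mono e4)
    show "norm (of_real x * e1) \<le> x * \<bar>u\<bar> ^ 3"
      using x e1 by (simp add: norm_mult mult_left_mono)
    show "norm (of_real (x * b) * e2) \<le> x * d * \<bar>u\<bar> ^ 3"
      using x b e2 by (simp add: norm_mult) (intro mult_mono; simp)
    show "norm (e3 / 2) \<le> (1 + d) * (3 + d) * (\<bar>u\<bar> ^ 3 * x)"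
      using e3 norm_ge_zero[of e3] by (simp only: norm_divide norm_numeral)
  qed
  also have "\<dots> = (1 + d + (1 + d) * (3 + d) + (2 + d) ^ 3 * exp (2 + d)) * (\<bar>u\<bar> ^ 3 * x)"
    by (simp add: algebra_simps)
  finally show ?thesis .
qed

text \<open>
  The truncated subtractions encode the convention that \<open>f\<close> is constantly \<open>f 0\<close> at negative
  indices. Expanding the delayed term \<open>f (i - d)\<close> to first order around \<open>f i\<close> makes the recursion
  multiplicative.
\<close>
lemma delayed_recursion_bound:
  fixes f :: "nat \<Rightarrow> complex" and x :: "nat \<Rightarrow> real" and d :: nat and u :: real
  assumes u: "\<bar>u\<bar> \<le> 1" and x: "\<And>i. 0 \<le> x i" "\<And>i. x i \<le> 1"
    and f_le: "\<And>i. norm (f i) \<le> 1"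
    and rec: "\<And>i. f (Suc i) = f i + (iexp u - 1) * of_real (x i) * f (i - d)"
  defines "b \<equiv> \<lambda>i. \<Sum>j\<in>{i - d..<i}. x j"
  shows "norm (f (Suc i) - f i * exp (\<i> * of_real (u * x i)
            - of_real (u\<^sup>2 * (x i * (1 - x i - 2 * b i)) / 2)))
    \<le> (2 * d\<^sup>2 + (1 + real d + (1 + real d) * (3 + real d) + (2 + real d) ^ 3 * exp (2 + real d))) * (\<bar>u\<bar> ^ 3 * x i)"
proof -
  define z where "z = iexp u - 1"
  define w where "w = \<i> * of_real (u * x i) - of_real (u\<^sup>2 * (x i * (1 - x i - 2 * b i)) / 2)"
  have z: "norm z \<le> \<bar>u\<bar>" unfolding z_def by (rule norm_iexp_minus_one_le)
  have b: "0 \<le> b i" "b i \<le> real d"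
  proof -
    show "0 \<le> b i" unfolding b_def by (intro sum_nonneg x)
    have "b i \<le> (\<Sum>j\<in>{i - d..<i}. 1)" unfolding b_def by (intro sum_mono x)
    also have "\<dots> \<le> real d" by simp
    finally show "b i \<le> real d" .
  qed
  have diff: "f n - f m = z * (\<Sum>j\<in>{m..<n}. of_real (x j) * f (j - d))" if "m \<le> n" for m n
    using that
  proof (induction rule: dec_induct)
    case (step k)
    then show ?case by (simp add: rec algebra_simps flip: z_def)
  qed simp
  have near: "norm (f m - f n) \<le> real (n - m) * \<bar>u\<bar>" if "m \<le> n" for m n
  proof -
    have "norm (f m - f n) = norm z * norm (\<Sum>j\<in>{m..<n}. of_real (x j) * f (j - d))"
      using diff[OF that] by (subst norm_minus_commute) (simp add: norm_mult)
    also have "\<dots> \<le> \<bar>u\<bar> * (\<Sum>j\<in>{m..<n}. 1)"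
      using x f_le by (intro mult_mono z sum_norm_le) (auto simp: norm_mult intro!: mult_le_one)
    finally show ?thesis by (simp add: mult.commute)
  qed
  \<comment> \<open>\<open>e\<close> is the error of replacing each \<open>f (j - d)\<close> in the
    sum over the delay window by \<open>f i\<close>. There are at most \<open>d\<close> terms, each
    with an index lag of at most \<open>2 * d\<close>, and \<open>f\<close> moves by at most
    \<open>\<bar>u\<bar>\<close> per step.\<close>
  define e where "e = (\<Sum>j\<in>{i - d..<i}. of_real (x j) * (f (j - d) - f i))"
  have e: "norm e \<le> 2 * d\<^sup>2 * \<bar>u\<bar>"
  proof -
    have "norm e \<le> (\<Sum>j\<in>{i - d..<i}. 1 * (2 * d * \<bar>u\<bar>))"
      unfolding e_def
    proof (rule sum_norm_le)
      fix j assume j: "j \<in> {i - d..<i}"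
      have "norm (f (j - d) - f i) \<le> real (i - (j - d)) * \<bar>u\<bar>"
        using j by (intro near) auto
      also have "\<dots> \<le> (2 * d) * \<bar>u\<bar>"
      proof (intro mult_right_mono)
        have "i - (j - d) \<le> 2 * d" using j by auto
        then show "real (i - (j - d)) \<le> real (2 * d)" by (simp only: of_nat_le_iff)
      qed simp
      finally have "norm (f (j - d) - f i) \<le> 2 * d * \<bar>u\<bar>" by simp
      then show "norm (of_real (x j) * (f (j - d) - f i)) \<le> 1 * (2 * d * \<bar>u\<bar>)"
        unfolding norm_mult using x[of j] by (intro mult_mono) auto
    qed
    also have "\<dots> = real (card {i - d..<i}) * (2 * d * \<bar>u\<bar>)" by simp
    also have "\<dots> \<le> real d * (2 * d * \<bar>u\<bar>)" by (intro mult_right_mono) auto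
    finally show ?thesis by (simp add: power2_eq_square algebra_simps)
  qed
  have "(\<Sum>j\<in>{i - d..<i}. of_real (x j) * f (j - d)) = of_real (b i) * f i + e"
    by (simp add: e_def b_def right_diff_distrib sum_subtractf sum_distrib_right)
  then have "f (i - d) = f i - z * (of_real (b i) * f i + e)"
    using diff[of "i - d" i] by (simp add: algebra_simps)
  \<comment> \<open>Inserting the expansion of \<open>f (i - d)\<close> into the recursion gives the
    multiplier of \<open>one_step_multiplier_bound\<close>, with a remainder carrying
    \<open>z\<^sup>2 * e\<close>, which is of third order.\<close>
  from arg_cong[OF this, of "\<lambda>y. f i + z * of_real (x i) * y"] have "f (Suc i) = f i * (1 + z * of_real (x i) - z\<^sup>2 * of_real (x i * b i)) - z\<^sup>2 * of_real (x i) * e"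
    by (simp add: rec algebra_simps power2_eq_square flip: z_def)
  then have "f (Suc i) - f i * exp w
      = f i * (1 + z * of_real (x i) - z\<^sup>2 * of_real (x i * b i) - exp w) - z\<^sup>2 * of_real (x i) * e"
    by (simp add: algebra_simps)
  also have "norm \<dots> \<le> norm (f i * (1 + z * of_real (x i) - z\<^sup>2 * of_real (x i * b i) - exp w))
      + norm (z\<^sup>2 * of_real (x i) * e)"
    by (rule norm_triangle_ineq4)
  also have "\<dots> \<le> 1 * ((1 + real d + (1 + real d) * (3 + real d) + (2 + real d) ^ 3 * exp (2 + real d)) * (\<bar>u\<bar> ^ 3 * x i))
      + \<bar>u\<bar>\<^sup>2 * x i * (2 * d\<^sup>2 * \<bar>u\<bar>)"
  proof (intro add_mono)
    show "norm (f i * (1 + z * of_real (x i) - z\<^sup>2 * of_real (x i * b i) - exp w))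
        \<le> 1 * ((1 + real d + (1 + real d) * (3 + real d) + (2 + real d) ^ 3 * exp (2 + real d)) * (\<bar>u\<bar> ^ 3 * x i))"
      unfolding norm_mult z_def w_def
      by (intro mult_mono f_le one_step_multiplier_bound u x b) auto
    show "norm (z\<^sup>2 * of_real (x i) * e) \<le> \<bar>u\<bar>\<^sup>2 * x i * (2 * d\<^sup>2 * \<bar>u\<bar>)"
      unfolding norm_mult norm_power using x z e by (intro mult_mono power_mono) auto
  qed
  also have "\<dots> = (2 * d\<^sup>2 + (1 + real d + (1 + real d) * (3 + real d) + (2 + real d) ^ 3 * exp (2 + real d))) * (\<bar>u\<bar> ^ 3 * x i)"
    by (simp add: algebra_simps power2_eq_square power3_eq_cube)
  finally show ?thesis by (simp add: w_def)
qed

text \<open>Multiplying the one-step factors produces the Gaussian, and the one-step errors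
  accumulate additively. The constant depends on \<open>d\<close> alone because \<open>u\<close>,
  \<open>f\<close> and \<open>m\<close> will all vary with \<open>n\<close>. The bound is written
  through \<open>u\<^sup>2 * (\<Sum>i<m. x i)\<close>, which converges in the application, so that
  the spare factor \<open>\<bar>u\<bar>\<close> sends it to zero.\<close>

lemma delayed_recursion_gaussian:
  fixes d :: nat
  obtains C :: real where
    "\<And>(f :: nat \<Rightarrow> complex) (x :: nat \<Rightarrow> real) (u :: real) m. \<lbrakk>\<bar>u\<bar> \<le> 1; \<And>i. 0 \<le> x i; \<And>i. x i \<le> 1; \<And>i. norm (f i) \<le> 1; f 0 = 1;
      \<And>i. f (Suc i) = f i + (iexp u - 1) * of_real (x i) * f (i - d)\<rbrakk> \<Longrightarrow>
      norm (f m * iexp (- u * (\<Sum>i<m. x i))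
        - of_real (exp (- u\<^sup>2 / 2 * (\<Sum>i<m. x i * (1 - x i - 2 * (\<Sum>j\<in>{i - d..<i}. x j))))))
      \<le> C * \<bar>u\<bar> * (u\<^sup>2 * (\<Sum>i<m. x i)) * exp (2 * (1 + d) * (u\<^sup>2 * (\<Sum>i<m. x i)))"
proof
  fix f :: "nat \<Rightarrow> complex" and x :: "nat \<Rightarrow> real" and u :: real and m :: nat
  assume u: "\<bar>u\<bar> \<le> 1" and x: "\<And>i. 0 \<le> x i" "\<And>i. x i \<le> 1"
    and f_le: "\<And>i. norm (f i) \<le> 1" and f0: "f 0 = 1"
    and rec: "\<And>i. f (Suc i) = f i + (iexp u - 1) * of_real (x i) * f (i - d)"
  define C where "C = 2 * d\<^sup>2 + (1 + real d + (1 + real d) * (3 + real d) + (2 + real d) ^ 3 * exp (2 + real d))"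
  define c where "c i = x i * (1 - x i - 2 * (\<Sum>j\<in>{i - d..<i}. x j))" for i
  define w where "w i = \<i> * of_real (u * x i) - of_real (u\<^sup>2 * c i / 2)" for i
  define W where "W k = (\<Sum>i<k. w i)" for k
  define S where "S = (\<Sum>i<m. x i)"
  have step: "norm (f (Suc i) - f i * exp (w i)) \<le> C * (\<bar>u\<bar> ^ 3 * x i)" for i
    unfolding C_def w_def c_def using delayed_recursion_bound[OF u x f_le rec] .
  have C: "0 \<le> C" unfolding C_def by (intro add_nonneg_nonneg mult_nonneg_nonneg) auto
  have c_abs: "\<bar>c i\<bar> \<le> 2 * (1 + d) * x i" for i
  proof -
    have "(\<Sum>j\<in>{i - d..<i}. x j) \<le> (\<Sum>j\<in>{i - d..<i}. 1)" by (intro sum_mono x)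
    also have "\<dots> \<le> real d" by simp
    finally have "(\<Sum>j\<in>{i - d..<i}. x j) \<le> real d" .
    moreover have "0 \<le> (\<Sum>j\<in>{i - d..<i}. x j)" by (intro sum_nonneg x)
    ultimately have "\<bar>1 - x i - 2 * (\<Sum>j\<in>{i - d..<i}. x j)\<bar> \<le> 2 * (1 + d)"
      using x[of i] by (simp add: abs_le_iff)
    then show ?thesis
      unfolding c_def abs_mult using x(1)[of i] by (simp add: mult.commute mult_left_mono)
  qed
  have ReW: "\<bar>Re (W k)\<bar> \<le> (1 + d) * (u\<^sup>2 * S)" if "k \<le> m" for k
  proof -
    have "Re (W k) = - (u\<^sup>2 / 2 * (\<Sum>i<k. c i))"
      by (simp add: W_def w_def sum_subtractf sum_negf sum_distrib_left)
    then have "\<bar>Re (W k)\<bar> = u\<^sup>2 / 2 * \<bar>\<Sum>i<k. c i\<bar>" by (simp add: abs_mult)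
    also have "\<bar>\<Sum>i<k. c i\<bar> \<le> (\<Sum>i<k. 2 * (1 + d) * x i)"
      by (intro order_trans[OF sum_abs] sum_mono c_abs)
    also have "\<dots> \<le> (\<Sum>i<m. 2 * (1 + d) * x i)"
      using that x by (intro sum_mono2) auto
    also have "u\<^sup>2 / 2 * \<dots> = (1 + d) * (u\<^sup>2 * S)"
      by (simp add: S_def flip: sum_distrib_left)
    finally show ?thesis by (simp add: mult_left_mono)
  qed
  define E where "E = exp ((1 + d) * (u\<^sup>2 * S))"
  \<comment> \<open>After normalising by \<open>exp (- W k)\<close> the main term is constantly 1,
    so the induction only adds up one-step errors, each amplified by at most
    \<open>E\<close>.\<close>
  have g: "norm (f k * exp (- W k) - 1) \<le> C * \<bar>u\<bar> ^ 3 * E * (\<Sum>i<k. x i)" if "k \<le> m" for k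
    using that
  proof (induction k)
    case 0
    then show ?case by (simp add: W_def f0)
  next
    case (Suc k)
    have "f (Suc k) * exp (- W (Suc k)) - 1
        = (f (Suc k) - f k * exp (w k)) * exp (- W (Suc k)) + (f k * exp (- W k) - 1)"
    proof -
      have "exp (- W k) = exp (w k) * exp (- W (Suc k))"
        by (simp add: W_def flip: exp_add)
      then show ?thesis by (simp add: algebra_simps)
    qed
    also have "norm \<dots> \<le> norm (f (Suc k) - f k * exp (w k)) * norm (exp (- W (Suc k)))
        + norm (f k * exp (- W k) - 1)"
      by (rule order_trans[OF norm_triangle_ineq]) (simp add: norm_mult)
    also have "\<dots> \<le> C * (\<bar>u\<bar> ^ 3 * x k) * E + C * \<bar>u\<bar> ^ 3 * E * (\<Sum>i<k. x i)"
    proof (intro add_mono mult_mono step)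
      show "norm (exp (- W (Suc k))) \<le> E"
        using ReW[OF Suc.prems] by (simp add: E_def)
      show "norm (f k * exp (- W k) - 1) \<le> C * \<bar>u\<bar> ^ 3 * E * (\<Sum>i<k. x i)"
        using Suc by simp
    qed (use C x in auto)
    finally show ?case by (simp add: algebra_simps)
  qed
  have Wm: "W m = \<i> * of_real (u * S) - of_real (u\<^sup>2 / 2 * (\<Sum>i<m. c i))"
    by (simp add: W_def w_def S_def sum_subtractf sum_distrib_left)
  have "f m * iexp (- u * S) - of_real (exp (- u\<^sup>2 / 2 * (\<Sum>i<m. c i)))
      = (f m * exp (- W m) - 1) * of_real (exp (- u\<^sup>2 / 2 * (\<Sum>i<m. c i)))"
  proof -
    have "iexp (- u * S) = exp (- W m) * of_real (exp (- u\<^sup>2 / 2 * (\<Sum>i<m. c i)))"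
      by (simp add: Wm flip: exp_of_real exp_add)
    then show ?thesis by (simp add: algebra_simps)
  qed
  also have "norm \<dots> = norm (f m * exp (- W m) - 1) * exp (Re (W m))"
    by (simp add: norm_mult Wm)
  \<comment> \<open>One factor \<open>E\<close> comes from the normalisation by
    \<open>exp (- W)\<close>, the other from multiplying back by the Gaussian; this explains the 2
    in the final exponent.\<close>
  also have "\<dots> \<le> (C * \<bar>u\<bar> ^ 3 * E * S) * E"
  proof (intro mult_mono)
    show "norm (f m * exp (- W m) - 1) \<le> C * \<bar>u\<bar> ^ 3 * E * S" using g[of m] by (simp add: S_def)
    show "exp (Re (W m)) \<le> E" using ReW[of m] by (simp add: E_def)
    show "0 \<le> C * \<bar>u\<bar> ^ 3 * E * S"
      using C x by (intro mult_nonneg_nonneg) (auto simp: E_def S_def intro: sum_nonneg)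
  qed simp
  also have "\<dots> = C * \<bar>u\<bar> * (u\<^sup>2 * S) * exp (2 * (1 + d) * (u\<^sup>2 * S))"
  proof -
    have "E * E = exp (2 * (1 + d) * (u\<^sup>2 * S))"
      unfolding E_def exp_add[symmetric] by (simp add: algebra_simps)
    moreover have "C * \<bar>u\<bar> ^ 3 * E * S * E = C * \<bar>u\<bar> * (u\<^sup>2 * S) * (E * E)"
      by (simp add: power3_eq_cube power2_eq_square)
    ultimately show ?thesis by simp
  qed
  finally show "norm (f m * iexp (- u * (\<Sum>i<m. x i))
        - of_real (exp (- u\<^sup>2 / 2 * (\<Sum>i<m. x i * (1 - x i - 2 * (\<Sum>j\<in>{i - d..<i}. x j))))))
      \<le> (2 * d\<^sup>2 + (1 + real d + (1 + real d) * (3 + real d) + (2 + real d) ^ 3 * exp (2 + real d))) * \<bar>u\<bar> * (u\<^sup>2 * (\<Sum>i<m. x i)) * exp (2 * (1 + d) * (u\<^sup>2 * (\<Sum>i<m. x i)))"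
    unfolding S_def c_def C_def .
qed

section \<open>Record values\<close>

definition record_values :: "(nat \<Rightarrow> 'a \<Rightarrow> nat) \<Rightarrow> nat \<Rightarrow> 'a \<Rightarrow> nat set" where
  "record_values X \<delta> \<omega> = {v. \<exists>n\<ge>1. X n \<omega> = v \<and> runmax X (n - 1) \<omega> + \<delta> < v}"

definition Drec :: "(nat \<Rightarrow> 'a \<Rightarrow> nat) \<Rightarrow> nat \<Rightarrow> nat \<Rightarrow> 'a \<Rightarrow> nat" where
  "Drec X \<delta> m \<omega> = card (record_values X \<delta> \<omega> \<inter> {..m})"

lemma runmax_0: "runmax X 0 \<omega> = 0"
  by (simp add: runmax_def)

lemma runmax_Suc: "runmax X (Suc n) \<omega> = max (runmax X n \<omega>) (X (Suc n) \<omega>)"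
proof -
  have "{1..Suc n} = insert (Suc n) {1..n}" by auto
  then have "insert 0 ((\<lambda>k. X k \<omega>) ` {1..Suc n}) = insert (X (Suc n) \<omega>) (insert 0 ((\<lambda>k. X k \<omega>) ` {1..n}))"
    by auto
  then show ?thesis by (simp add: runmax_def max.commute)
qed

lemma runmax_le_iff: "runmax X n \<omega> \<le> i \<longleftrightarrow> (\<forall>k\<in>{1..n}. X k \<omega> \<le> i)"
  by (simp add: runmax_def)

lemma le_runmax: "1 \<le> k \<Longrightarrow> k \<le> n \<Longrightarrow> X k \<omega> \<le> runmax X n \<omega>"
  using runmax_le_iff[of X n \<omega> "runmax X n \<omega>"] by auto

lemma le_runmax_pred: "1 \<le> k \<Longrightarrow> k < n \<Longrightarrow> X k \<omega> \<le> runmax X (n - 1) \<omega>"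
  by (intro le_runmax) auto

lemma runmax_cong: "(\<And>k. 1 \<le> k \<Longrightarrow> k \<le> n \<Longrightarrow> X k \<omega> = Y k \<omega>') \<Longrightarrow> runmax X n \<omega> = runmax Y n \<omega>'"
  unfolding runmax_def by (intro arg_cong[where f = Max] arg_cong[where f = "insert 0"] image_cong) auto

lemma Nrec_0: "Nrec X \<delta> 0 \<omega> = 0"
  by (simp add: Nrec_def)

lemma Nrec_Suc:
  "Nrec X \<delta> (Suc n) \<omega> = Nrec X \<delta> n \<omega> + (if runmax X n \<omega> + \<delta> < X (Suc n) \<omega> then 1 else 0)"
proof -
  have "{k \<in> {1..Suc n}. X k \<omega> > runmax X (k - 1) \<omega> + \<delta>} =
    (if runmax X n \<omega> + \<delta> < X (Suc n) \<omega> then insert (Suc n) else id)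
      {k \<in> {1..n}. X k \<omega> > runmax X (k - 1) \<omega> + \<delta>}"
    by (auto simp: le_Suc_eq)
  then show ?thesis by (simp add: Nrec_def)
qed

text \<open>The larger record value must occur later in time: had it come first, the smaller one
  could not have exceeded the running maximum. When the larger one occurs, the running maximum is
  already at least \<open>v\<close>.\<close>

lemma record_values_spaced:
  assumes "v \<in> record_values X \<delta> \<omega>" "w \<in> record_values X \<delta> \<omega>" "v < w"
  shows "v + \<delta> < w"
proof -
  obtain n where n: "n \<ge> 1" "X n \<omega> = v" "runmax X (n - 1) \<omega> + \<delta> < v"
    using assms(1) by (auto simp: record_values_def)
  obtain k where k: "k \<ge> 1" "X k \<omega> = w" "runmax X (k - 1) \<omega> + \<delta> < w"
    using assms(2) by (auto simp: record_values_def)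
  have "\<not> k < n" using le_runmax_pred[of k n X \<omega>] n k assms(3) by auto
  moreover have "n \<noteq> k" using n k assms(3) by auto
  ultimately have "X n \<omega> \<le> runmax X (k - 1) \<omega>" using n by (intro le_runmax) auto
  then show ?thesis using n k by simp
qed

lemma record_values_gt: "v \<in> record_values X \<delta> \<omega> \<Longrightarrow> \<delta> < v"
  by (auto simp: record_values_def)

lemma Drec_Suc:
  "Drec X \<delta> (Suc m) \<omega> = Drec X \<delta> m \<omega> + of_bool (Suc m \<in> record_values X \<delta> \<omega>)"
proof -
  have "record_values X \<delta> \<omega> \<inter> {..Suc m} =
    (if Suc m \<in> record_values X \<delta> \<omega> then insert (Suc m) else id) (record_values X \<delta> \<omega> \<inter> {..m})"
    by (auto simp: le_Suc_eq)
  then show ?thesis by (simp add: Drec_def)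
qed

lemma Drec_small: "m \<le> \<delta> \<Longrightarrow> Drec X \<delta> m \<omega> = 0"
  unfolding Drec_def using record_values_gt[of _ X \<delta> \<omega>] by fastforce

lemma Drec_mono: "l \<le> m \<Longrightarrow> Drec X \<delta> l \<omega> \<le> Drec X \<delta> m \<omega>"
  unfolding Drec_def by (intro card_mono) auto

text \<open>By the spacing, none of the \<open>\<delta>\<close> values just below a record value is
  itself a record value. This is the source of the delay in the recursion for
  \<open>phi\<close>.\<close>

lemma Drec_before_record:
  assumes "Suc (m + \<delta>) \<in> record_values X \<delta> \<omega>"
  shows "Drec X \<delta> (m + \<delta>) \<omega> = Drec X \<delta> m \<omega>"
proof -
  have "v \<le> m" if "v \<in> record_values X \<delta> \<omega>" "v \<le> m + \<delta>" for v
    using record_values_spaced[OF that(1) assms] that(2) by auto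
  then have "record_values X \<delta> \<omega> \<inter> {..m + \<delta>} = record_values X \<delta> \<omega> \<inter> {..m}" by fastforce
  then show ?thesis by (simp add: Drec_def)
qed

text \<open>Record values strictly increase with their times, so mapping each record time to its
  value is injective. It reaches every record value up to the current maximum, because a record
  after time \<open>n\<close> would exceed that maximum.\<close>

lemma Nrec_eq_Drec: "Nrec X \<delta> n \<omega> = Drec X \<delta> (runmax X n \<omega>) \<omega>"
proof -
  define T where "T = {k \<in> {1..n}. X k \<omega> > runmax X (k - 1) \<omega> + \<delta>}"
  have "bij_betw (\<lambda>k. X k \<omega>) T (record_values X \<delta> \<omega> \<inter> {..runmax X n \<omega>})"
  proof (rule bij_betwI')
    fix j k assume jk: "j \<in> T" "k \<in> T"
    have "X i \<omega> < X k \<omega>" if "i \<in> T" "k \<in> T" "i < k" for i k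
      using le_runmax_pred[of i k X \<omega>] that by (auto simp: T_def)
    then show "(X j \<omega> = X k \<omega>) \<longleftrightarrow> j = k"
      using jk by (metis linorder_neqE_nat less_irrefl)
  next
    fix k assume "k \<in> T"
    then show "X k \<omega> \<in> record_values X \<delta> \<omega> \<inter> {..runmax X n \<omega>}"
      using le_runmax[of k n X \<omega>] by (auto simp: T_def record_values_def)
  next
    fix v assume v: "v \<in> record_values X \<delta> \<omega> \<inter> {..runmax X n \<omega>}"
    then obtain k where k: "k \<ge> 1" "X k \<omega> = v" "runmax X (k - 1) \<omega> + \<delta> < v"
      by (auto simp: record_values_def)
    have "k \<le> n"
    proof (rule ccontr)
      assume "\<not> k \<le> n"
      then have "runmax X n \<omega> \<le> runmax X (k - 1) \<omega>"
        by (subst runmax_le_iff) (auto intro!: le_runmax)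
      then show False using v k by auto
    qed
    then show "\<exists>k\<in>T. v = X k \<omega>" using k by (auto simp: T_def)
  qed
  then show ?thesis by (simp add: Nrec_def Drec_def T_def bij_betw_same_card)
qed

text \<open>At the first observation exceeding \<open>i\<close> the record values up to \<open>i\<close> are settled, and that
  observation alone decides whether \<open>Suc (i + \<delta>)\<close> is a record value.\<close>
lemma first_exceedance:
  assumes below: "runmax X n \<omega> \<le> i" and above: "i < X (Suc n) \<omega>"
  shows "Drec X \<delta> i \<omega> = Nrec X \<delta> n \<omega>"
    and "Suc (i + \<delta>) \<in> record_values X \<delta> \<omega> \<longleftrightarrow> X (Suc n) \<omega> = Suc (i + \<delta>)"
proof -
  have later: "i < runmax X (k - 1) \<omega>" if "Suc n < k" for k
    using le_runmax_pred[of "Suc n" k X \<omega>] that above by auto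
  have earlier: "X k \<omega> \<le> runmax X n \<omega>" if "1 \<le> k" "k < Suc n" for k
    using that by (intro le_runmax) auto
  have "v \<le> runmax X n \<omega>" if v: "v \<in> record_values X \<delta> \<omega>" "v \<le> i" for v
  proof -
    obtain k where k: "k \<ge> 1" "X k \<omega> = v" "runmax X (k - 1) \<omega> + \<delta> < v"
      using v by (auto simp: record_values_def)
    have "\<not> Suc n < k" "k \<noteq> Suc n" using later[of k] k v above by auto
    then show ?thesis using earlier[of k] k by auto
  qed
  then have "record_values X \<delta> \<omega> \<inter> {..i} = record_values X \<delta> \<omega> \<inter> {..runmax X n \<omega>}"
    using below by fastforce
  then show "Drec X \<delta> i \<omega> = Nrec X \<delta> n \<omega>" by (simp add: Nrec_eq_Drec Drec_def)
  show "Suc (i + \<delta>) \<in> record_values X \<delta> \<omega> \<longleftrightarrow> X (Suc n) \<omega> = Suc (i + \<delta>)"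
  proof
    assume "Suc (i + \<delta>) \<in> record_values X \<delta> \<omega>"
    then obtain k where k: "k \<ge> 1" "X k \<omega> = Suc (i + \<delta>)" "runmax X (k - 1) \<omega> + \<delta> < Suc (i + \<delta>)"
      by (auto simp: record_values_def)
    have "\<not> Suc n < k" using later[of k] k by auto
    moreover have "\<not> k < Suc n" using earlier[of k] k below by auto
    ultimately have "k = Suc n" by simp
    then show "X (Suc n) \<omega> = Suc (i + \<delta>)" using k by simp
  next
    assume "X (Suc n) \<omega> = Suc (i + \<delta>)"
    then show "Suc (i + \<delta>) \<in> record_values X \<delta> \<omega>"
      using below unfolding record_values_def by (intro CollectI exI[of _ "Suc n"]) auto
  qed
qed

section \<open>The i.i.d. model\<close>

text \<open>An arbitrary measurable space is allowed so that the result applies both to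
  \<open>X\<close> on \<open>M\<close> and to the coordinate process on a product space; the same
  holds for \<open>measurable_Nrec\<close>.\<close>

lemma measurable_runmax:
  assumes "\<And>i. i \<in> {1..n} \<Longrightarrow> Y i \<in> measurable N (count_space UNIV)"
  shows "runmax Y n \<in> measurable N (count_space UNIV)"
  using assms
proof (induction n)
  case 0
  then show ?case by (simp add: runmax_0[abs_def] cong: measurable_cong)
next
  case (Suc n)
  have [measurable]: "runmax Y n \<in> measurable N (count_space UNIV)"
    "Y (Suc n) \<in> measurable N (count_space UNIV)"
    using Suc by auto
  have "runmax Y (Suc n) = (\<lambda>\<omega>. max (runmax Y n \<omega>) (Y (Suc n) \<omega>))"
    by (simp add: runmax_Suc fun_eq_iff)
  then show ?case by simp
qed

lemma measurable_Nrec: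
  assumes "\<And>i. i \<in> {1..n} \<Longrightarrow> Y i \<in> measurable N (count_space UNIV)"
  shows "Nrec Y \<delta> n \<in> measurable N (count_space UNIV)"
  using assms
proof (induction n)
  case 0
  then show ?case by (simp add: Nrec_0[abs_def] cong: measurable_cong)
next
  case (Suc n)
  have [measurable]: "Nrec Y \<delta> n \<in> measurable N (count_space UNIV)"
    "runmax Y n \<in> measurable N (count_space UNIV)"
    "Y (Suc n) \<in> measurable N (count_space UNIV)"
    using Suc by (auto intro: measurable_runmax)
  have "Nrec Y \<delta> (Suc n) = (\<lambda>\<omega>. Nrec Y \<delta> n \<omega> + (if runmax Y n \<omega> + \<delta> < Y (Suc n) \<omega> then 1 else 0))"
    by (simp add: Nrec_Suc fun_eq_iff)
  then show ?case by simp
qed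

lemma Nrec_cong:
  assumes "\<And>k. 1 \<le> k \<Longrightarrow> k \<le> n \<Longrightarrow> X k \<omega> = Y k \<omega>'"
  shows "Nrec X \<delta> n \<omega> = Nrec Y \<delta> n \<omega>'"
proof -
  have "runmax X (k - 1) \<omega> = runmax Y (k - 1) \<omega>'" if "k \<in> {1..n}" for k
    using that assms by (intro runmax_cong) auto
  then show ?thesis unfolding Nrec_def using assms by (intro arg_cong[where f = card]) auto
qed

locale record_model = prob_space M for M :: "'a measure" +
  fixes X :: "nat \<Rightarrow> 'a \<Rightarrow> nat" and p :: "nat \<Rightarrow> real" and \<delta> :: nat
  assumes indep: "indep_vars (\<lambda>_. count_space UNIV) X {1..}"
    and distr: "\<And>i k. i \<ge> 1 \<Longrightarrow> prob {\<omega> \<in> space M. X i \<omega> = k} = p k"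
    and ppos: "\<And>k. p k > 0"
begin

lemma rv_X: "i \<ge> 1 \<Longrightarrow> X i \<in> measurable M (count_space UNIV)"
  using indep by (auto simp: indep_vars_def)

lemma rv_X_Suc [measurable]: "X (Suc i) \<in> measurable M (count_space UNIV)"
  by (rule rv_X) simp

lemma rv_runmax [measurable]: "runmax X n \<in> measurable M (count_space UNIV)"
  by (rule measurable_runmax) (auto intro: rv_X)

lemma rv_Nrec [measurable]: "Nrec X \<delta> n \<in> measurable M (count_space UNIV)"
  by (rule measurable_Nrec) (auto intro: rv_X)

lemma record_values_measurable [measurable]: "Measurable.pred M (\<lambda>\<omega>. k \<in> record_values X \<delta> \<omega>)"
proof -
  have "(\<lambda>\<omega>. k \<in> record_values X \<delta> \<omega>) = (\<lambda>\<omega>. \<exists>n. X (Suc n) \<omega> = k \<and> runmax X n \<omega> + \<delta> < k)"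
    unfolding record_values_def by (auto simp: fun_eq_iff gr0_conv_Suc Suc_le_eq intro: exI[of _ "Suc _"])
  then show ?thesis by simp
qed

lemma rv_Drec [measurable]: "Drec X \<delta> m \<in> measurable M (count_space UNIV)"
proof (induction m)
  case 0
  have "Drec X \<delta> 0 = (\<lambda>_. 0)" by (simp add: Drec_small fun_eq_iff)
  then show ?case by simp
next
  case (Suc m)
  note [measurable] = Suc
  have "Drec X \<delta> (Suc m) = (\<lambda>\<omega>. if Suc m \<in> record_values X \<delta> \<omega> then Suc (Drec X \<delta> m \<omega>) else Drec X \<delta> m \<omega>)"
    by (simp add: Drec_Suc fun_eq_iff)
  then show ?case by simp
qed

section \<open>Tails and conditional probabilities of the common law\<close>

lemma p_sums: "p sums 1"
proof -
  have "(\<lambda>k. prob {\<omega> \<in> space M. X 1 \<omega> = k}) sums prob (\<Union>k. {\<omega> \<in> space M. X 1 \<omega> = k})"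
    using rv_X[of 1] by (intro finite_measure_UNION) (auto simp: disjoint_family_on_def)
  also have "(\<Union>k. {\<omega> \<in> space M. X 1 \<omega> = k}) = space M" by auto
  finally show ?thesis using distr[of 1] by (simp add: prob_space)
qed

lemma ytail_eq: "ytail p k = 1 - (\<Sum>i\<le>k. p i)"
  using suminf_minus_initial_segment[OF sums_summable[OF p_sums], of "Suc k"] p_sums
  by (simp add: ytail_def sums_iff lessThan_Suc_atMost)

lemma ytail_Suc: "ytail p (Suc k) = ytail p k - p (Suc k)"
  by (simp add: ytail_eq)

lemma ytail_antimono: "i \<le> j \<Longrightarrow> ytail p j \<le> ytail p i"
  by (rule lift_Suc_antimono_le) (simp_all add: ytail_Suc ppos order.strict_implies_order)

lemma ytail_pos: "0 < ytail p k"
  unfolding ytail_def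
  using summable_ignore_initial_segment[OF sums_summable[OF p_sums], of "k + 1"]
  by (intro suminf_pos) (auto simp: add.assoc ppos)

lemma ytail_tendsto_0: "ytail p \<longlonglongrightarrow> 0"
proof -
  have "(\<lambda>k. 1 - (\<Sum>i\<le>k. p i)) \<longlonglongrightarrow> 1 - 1"
    using p_sums by (intro tendsto_diff tendsto_const) (simp add: sums_def_le)
  then show ?thesis by (simp add: ytail_eq[abs_def])
qed

lemma yprev_eq: "yprev p k = ytail p k + p k"
  by (cases k) (simp_all add: yprev_def ytail_eq)

lemma yprev_pos: "0 < yprev p k"
  using ytail_pos[of k] ppos[of k] by (simp add: yprev_eq)

lemma one_minus_rk: "1 - rk p k = ytail p k / yprev p k"
  using yprev_pos[of k] by (simp add: rk_def yprev_eq field_simps)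

lemma rk_pos: "0 < rk p k"
  using yprev_pos[of k] ppos[of k] by (simp add: rk_def)

lemma rk_less_1: "rk p k < 1"
  using one_minus_rk[of k] divide_pos_pos[OF ytail_pos[of k] yprev_pos[of k]] by linarith

text \<open>The factor \<open>1 - rk p j\<close> is the ratio of two consecutive tails, so the
  product telescopes. In probabilistic terms it is the chance of an observation being at least
  \<open>k + d\<close>, given that it is at least \<open>k\<close>.\<close>

lemma ek_eq: "ek p d k = yprev p (k + d) / yprev p k"
proof (induction d)
  case 0
  then show ?case using yprev_pos[of k] by (simp add: ek_def)
next
  case (Suc d)
  have "ek p (Suc d) k = ek p d k * (1 - rk p (k + d))" by (simp add: ek_def)
  also have "\<dots> = yprev p (k + Suc d) / yprev p k"
    using yprev_pos[of "k + d"] by (simp add: Suc one_minus_rk yprev_def[of p "Suc _"])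
  finally show ?case .
qed

text \<open>This is the chain rule for conditional probabilities: given a value of at least
  \<open>k\<close>, first reach \<open>k + d\<close>, then be exactly \<open>k + d\<close>.\<close>

lemma sk_eq: "sk p d k = rk p (k + d) * ek p d k"
  using yprev_pos[of "k + d"] by (simp add: sk_def ek_eq rk_def)

lemma ek_pos: "0 < ek p d k"
  using yprev_pos by (simp add: ek_eq)

lemma ek_le_1: "ek p d k \<le> 1"
  unfolding ek_def using rk_pos rk_less_1 by (intro prod_le_1) (auto intro: less_imp_le)

lemma sk_pos: "0 < sk p d k"
  by (simp add: sk_eq ek_pos rk_pos)

lemma sk_le_rk: "sk p d k \<le> rk p (k + d)"
  unfolding sk_eq using ek_le_1 rk_pos by (intro mult_left_le) (auto intro: less_imp_le)

lemma sk_le_ek: "sk p d k \<le> ek p d k"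
  unfolding sk_eq using ek_pos[of d k] rk_less_1[of "k + d"] by (simp add: mult_left_le_one_le rk_pos less_imp_le)

lemma sk_le_1: "sk p d k \<le> 1"
  using sk_le_ek ek_le_1 order_trans by blast

section \<open>Law of the running maximum and independence of the next observation\<close>

lemma prob_X_le:
  assumes "i \<ge> 1"
  shows "prob {\<omega> \<in> space M. X i \<omega> \<le> h} = 1 - ytail p h"
proof -
  have "{\<omega> \<in> space M. X i \<omega> \<le> h} = (\<Union>k\<le>h. {\<omega> \<in> space M. X i \<omega> = k})" by auto
  moreover have "prob (\<Union>k\<le>h. {\<omega> \<in> space M. X i \<omega> = k}) = (\<Sum>k\<le>h. prob {\<omega> \<in> space M. X i \<omega> = k})"
    using rv_X[OF assms] by (intro finite_measure_finite_Union) (auto simp: disjoint_family_on_def)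
  ultimately show ?thesis using distr[OF assms] by (simp add: ytail_eq)
qed

lemma prob_X_gt:
  assumes "i \<ge> 1"
  shows "prob {\<omega> \<in> space M. h < X i \<omega>} = ytail p h"
proof -
  have "{\<omega> \<in> space M. h < X i \<omega>} = space M - {\<omega> \<in> space M. X i \<omega> \<le> h}" by auto
  then show ?thesis using rv_X[OF assms] by (simp add: prob_compl prob_X_le[OF assms])
qed

lemma prob_runmax_le: "prob {\<omega> \<in> space M. runmax X n \<omega> \<le> i} = (1 - ytail p i) ^ n"
proof (cases "n = 0")
  case True
  then show ?thesis by (simp add: runmax_0 prob_space)
next
  case False
  have "{\<omega> \<in> space M. runmax X n \<omega> \<le> i} = (\<Inter>k\<in>{1..n}. X k -` {..i} \<inter> space M)"
    using False by (auto simp: runmax_le_iff)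
  also have "prob \<dots> = (\<Prod>k\<in>{1..n}. prob (X k -` {..i} \<inter> space M))"
    using False by (intro indep_varsD[OF indep]) auto
  also have "\<dots> = (\<Prod>k\<in>{1..n}. 1 - ytail p i)"
    by (intro prod.cong refl) (auto simp: Int_def vimage_def conj_commute simp flip: prob_X_le)
  finally show ?thesis by simp
qed

lemma prob_runmax_gt: "prob {\<omega> \<in> space M. i < runmax X n \<omega>} \<le> n * ytail p i"
proof -
  have "{\<omega> \<in> space M. i < runmax X n \<omega>} = (\<Union>k\<in>{1..n}. {\<omega> \<in> space M. i < X k \<omega>})"
    using runmax_le_iff[of X n _ i] by (auto simp: not_le[symmetric])
  also have "prob \<dots> \<le> (\<Sum>k\<in>{1..n}. prob {\<omega> \<in> space M. i < X k \<omega>})"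
    using rv_X by (intro finite_measure_subadditive_finite) (auto intro!: predE pred_intros_logic)
  also have "\<dots> = n * ytail p i" by (simp add: prob_X_gt)
  finally show ?thesis .
qed

text \<open>The count and the maximum at time \<open>n\<close> are functions of the restriction of
  the sequence to \<open>{1..n}\<close>, which is independent of its restriction to
  \<open>{Suc n}\<close>. Boundedness supplies the integrability for the product formula.\<close>

lemma integral_past_times_next:
  fixes g :: "nat \<Rightarrow> nat \<Rightarrow> complex" and h :: "nat \<Rightarrow> complex"
  assumes g: "\<And>a b. norm (g a b) \<le> B" and h: "\<And>a. norm (h a) \<le> B'"
  shows "expectation (\<lambda>\<omega>. g (Nrec X \<delta> n \<omega>) (runmax X n \<omega>) * h (X (Suc n) \<omega>))
    = expectation (\<lambda>\<omega>. g (Nrec X \<delta> n \<omega>) (runmax X n \<omega>)) * expectation (\<lambda>\<omega>. h (X (Suc n) \<omega>))"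
proof -
  \<comment> \<open>\<open>Y1\<close> and \<open>Y2\<close> are the same functionals evaluated on
    the coordinate process, so composing them with the two restrictions recovers the original
    variables.\<close>
  define Y1 :: "(nat \<Rightarrow> nat) \<Rightarrow> complex" where
    "Y1 = (\<lambda>f. g (Nrec (\<lambda>i f. f i) \<delta> n f) (runmax (\<lambda>i f. f i) n f))"
  define Y2 :: "(nat \<Rightarrow> nat) \<Rightarrow> complex" where "Y2 = (\<lambda>f. h (f (Suc n)))"
  have Y1: "Y1 \<in> measurable (PiM {1..n} (\<lambda>_. count_space UNIV)) borel"
    unfolding Y1_def
  proof (rule measurable_compose_countable[where g = "Nrec (\<lambda>i f. f i) \<delta> n"
        and f = "\<lambda>a f. g a (runmax (\<lambda>i f. f i) n f)"])
    show "Nrec (\<lambda>i f. f i) \<delta> n \<in> measurable (PiM {1..n} (\<lambda>_. count_space UNIV)) (count_space UNIV)"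
      by (rule measurable_Nrec) (rule measurable_component_singleton)
    have "runmax (\<lambda>i f. f i) n \<in> measurable (PiM {1..n} (\<lambda>_. count_space UNIV)) (count_space UNIV)"
      by (rule measurable_runmax) (rule measurable_component_singleton)
    then show "(\<lambda>f. g a (runmax (\<lambda>i f. f i) n f)) \<in> measurable (PiM {1..n} (\<lambda>_. count_space UNIV)) borel" for a
      by (rule measurable_compose) simp
  qed
  have Y2: "Y2 \<in> measurable (PiM {Suc n} (\<lambda>_. count_space UNIV)) borel"
    unfolding Y2_def by (rule measurable_compose[OF measurable_component_singleton]) auto
  have "indep_var borel (Y1 \<circ> (\<lambda>\<omega>. restrict (\<lambda>i. X i \<omega>) {1..n})) borel (Y2 \<circ> (\<lambda>\<omega>. restrict (\<lambda>i. X i \<omega>) {Suc n}))"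
    by (intro indep_var_compose[OF indep_var_restrict[OF indep]] Y1 Y2) auto
  moreover have "Y1 \<circ> (\<lambda>\<omega>. restrict (\<lambda>i. X i \<omega>) {1..n}) = (\<lambda>\<omega>. g (Nrec X \<delta> n \<omega>) (runmax X n \<omega>))"
    by (auto simp: fun_eq_iff Y1_def intro!: arg_cong2[where f = g] Nrec_cong runmax_cong)
  moreover have "Y2 \<circ> (\<lambda>\<omega>. restrict (\<lambda>i. X i \<omega>) {Suc n}) = (\<lambda>\<omega>. h (X (Suc n) \<omega>))"
    by (simp add: fun_eq_iff Y2_def)
  ultimately have iv: "indep_var borel (\<lambda>\<omega>. g (Nrec X \<delta> n \<omega>) (runmax X n \<omega>)) borel (\<lambda>\<omega>. h (X (Suc n) \<omega>))"
    by simp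
  have "integrable M (\<lambda>\<omega>. g (Nrec X \<delta> n \<omega>) (runmax X n \<omega>))"
    using indep_var_rv1[OF iv] g by (intro integrable_const_bound[of _ B]) auto
  moreover have "integrable M (\<lambda>\<omega>. h (X (Suc n) \<omega>))"
    using indep_var_rv2[OF iv] h by (intro integrable_const_bound[of _ B']) auto
  ultimately show ?thesis by (intro indep_var_lebesgue_integral iv)
qed

end

lemma norm_iexp_diff_le: "norm (iexp x - iexp y) \<le> \<bar>x - y\<bar>"
proof -
  have "iexp x - iexp y = iexp y * (iexp (x - y) - 1)"
    by (simp add: algebra_simps flip: exp_add)
  then show ?thesis using norm_iexp_minus_one_le[of "x - y"] by (simp add: norm_mult)
qed

section \<open>The recursion for the characteristic functions of the record counts\<close>

context record_model
begin

lemma measurable_fun_Drec [measurable]: "(\<lambda>\<omega>. g (Drec X \<delta> m \<omega>)) \<in> borel_measurable M"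
  for g :: "nat \<Rightarrow> complex"
  by (rule measurable_compose[OF rv_Drec]) simp

lemma measurable_fun_Nrec [measurable]: "(\<lambda>\<omega>. g (Nrec X \<delta> m \<omega>)) \<in> borel_measurable M"
  for g :: "nat \<Rightarrow> complex"
  by (rule measurable_compose[OF rv_Nrec]) simp

lemma expectation_of_bool:
  assumes [measurable]: "Measurable.pred M P"
  shows "expectation (\<lambda>\<omega>. of_bool (P \<omega>)) = complex_of_real (prob {\<omega> \<in> space M. P \<omega>})"
    and "expectation (\<lambda>\<omega>. of_bool (P \<omega>)) = prob {\<omega> \<in> space M. P \<omega>}"
    and "integrable M (\<lambda>\<omega>. of_bool (P \<omega>) :: real)"
proof -
  have "expectation (\<lambda>\<omega>. of_bool (P \<omega>)) = expectation (indicator {\<omega> \<in> space M. P \<omega>} :: 'a \<Rightarrow> real)"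
    by (intro Bochner_Integration.integral_cong) (auto simp: indicator_def)
  also have "\<dots> = prob {\<omega> \<in> space M. P \<omega>}" by simp
  finally show real: "expectation (\<lambda>\<omega>. of_bool (P \<omega>)) = prob {\<omega> \<in> space M. P \<omega>}" .
  have "expectation (\<lambda>\<omega>. of_bool (P \<omega>)) = expectation (\<lambda>\<omega>. complex_of_real (of_bool (P \<omega>)))"
    by (intro Bochner_Integration.integral_cong) (auto split: split_of_bool)
  also have "\<dots> = complex_of_real (prob {\<omega> \<in> space M. P \<omega>})"
    by (simp only: integral_complex_of_real real)
  finally show "expectation (\<lambda>\<omega>. of_bool (P \<omega>)) = complex_of_real (prob {\<omega> \<in> space M. P \<omega>})" .
  show "integrable M (\<lambda>\<omega>. of_bool (P \<omega>) :: real)"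
    by (rule integrable_const_bound[of _ 1]) auto
qed

text \<open>Whether \<open>Suc (i + \<delta>)\<close> is a record value is decided by the first observation exceeding \<open>i\<close>,
  which is independent of all earlier observations, hence of the record values up to \<open>i\<close>.\<close>
lemma record_decoupling:
  fixes g :: "nat \<Rightarrow> complex"
  assumes g: "\<And>a. norm (g a) \<le> B"
  shows "expectation (\<lambda>\<omega>. of_bool (Suc (i + \<delta>) \<in> record_values X \<delta> \<omega>) * g (Drec X \<delta> i \<omega>))
    = of_real (sk p \<delta> (Suc i)) * expectation (\<lambda>\<omega>. g (Drec X \<delta> i \<omega>))"
proof -
  define k where "k = Suc (i + \<delta>)"
  define a where "a = sk p \<delta> (Suc i)"
  have a: "0 < a" "a \<le> 1"
    unfolding a_def by (rule sk_pos sk_le_1)+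
  \<comment> \<open>So \<open>a\<close> is the conditional probability that an observation equals
    \<open>k\<close>, given that it exceeds \<open>i\<close>.\<close>
  have p_k: "a * ytail p i = p k"
    using ytail_pos[of i] by (simp add: a_def k_def sk_def yprev_def)
  \<comment> \<open>The claim says that the centred variable \<open>h\<close> has expectation 0.
    This is first shown on the event that \<open>i\<close> has been exceeded by time
    \<open>n\<close>, and then \<open>n\<close> tends to infinity.\<close>
  define h where "h \<omega> = (of_bool (k \<in> record_values X \<delta> \<omega>) - of_real a) * g (Drec X \<delta> i \<omega>)" for \<omega>
  have B: "0 \<le> B" using g[of 0] norm_ge_zero order_trans by blast
  have h_le: "norm (h \<omega>) \<le> B" for \<omega>
  proof -
    have "norm (of_bool (k \<in> record_values X \<delta> \<omega>) - of_real a :: complex) \<le> 1"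
      using a norm_of_real[of "1 - a", where 'a = complex] by (auto split: split_of_bool)
    then show ?thesis
      unfolding h_def norm_mult using mult_mono[OF _ g, of _ 1] by simp
  qed
  have h_meas [measurable]: "h \<in> borel_measurable M"
    unfolding h_def by measurable
  have int: "integrable M (\<lambda>\<omega>. h \<omega> * of_bool (P \<omega>))" if [measurable]: "Measurable.pred M P" for P
    using h_le B by (intro integrable_const_bound[of _ B]) (auto split: split_of_bool)
  have zero: "expectation (\<lambda>\<omega>. h \<omega> * of_bool (i < runmax X n \<omega>)) = 0" for n
  proof (induction n)
    case 0
    then show ?case by (simp add: runmax_0)
  next
    case (Suc n)
    define G where "G a b = g a * of_bool (b \<le> i)" for a b
    define H where "H b = (of_bool (b = k) - of_real a * of_bool (i < b) :: complex)" for b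
    \<comment> \<open>Passing from \<open>n\<close> to \<open>Suc n\<close> adds exactly the event
      that observation \<open>Suc n\<close> is the first to exceed \<open>i\<close>. There
      \<open>first_exceedance\<close> writes \<open>h\<close> as a function of the past times a
      function of the next observation, and that second function has mean
      \<open>p k - a * ytail p i = 0\<close>.\<close>
    have split: "h \<omega> * of_bool (i < runmax X (Suc n) \<omega>)
        = h \<omega> * of_bool (i < runmax X n \<omega>) + G (Nrec X \<delta> n \<omega>) (runmax X n \<omega>) * H (X (Suc n) \<omega>)" for \<omega>
    proof (cases "i < runmax X n \<omega>")
      case True
      then show ?thesis by (simp add: G_def runmax_Suc less_max_iff_disj)
    next
      case False
      then show ?thesis
        using first_exceedance[of X n \<omega> i \<delta>]
        by (cases "i < X (Suc n) \<omega>") (auto simp: G_def H_def h_def runmax_Suc k_def)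
    qed
    have GH: "expectation (\<lambda>\<omega>. G (Nrec X \<delta> n \<omega>) (runmax X n \<omega>) * H (X (Suc n) \<omega>)) = 0"
    proof -
      have "expectation (\<lambda>\<omega>. H (X (Suc n) \<omega>)) = of_real (p k) - of_real a * of_real (ytail p i)"
      proof -
        have "expectation (\<lambda>\<omega>. H (X (Suc n) \<omega>)) = expectation (\<lambda>\<omega>. of_bool (X (Suc n) \<omega> = k))
            - expectation (\<lambda>\<omega>. of_real a * of_bool (i < X (Suc n) \<omega>))"
          unfolding H_def
          by (intro Bochner_Integration.integral_diff integrable_const_bound[of _ "max 1 \<bar>a\<bar>"])
             (auto simp: norm_mult split: split_of_bool)
        then show ?thesis by (simp add: expectation_of_bool distr prob_X_gt)
      qed
      also have "\<dots> = 0" using p_k by (simp flip: of_real_mult)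
      finally have "expectation (\<lambda>\<omega>. H (X (Suc n) \<omega>)) = 0" .
      moreover have "norm (G a b) \<le> B" for a b
        using g B by (auto simp: G_def split: split_of_bool)
      moreover have "norm (H b) \<le> 1 + \<bar>a\<bar>" for b
        unfolding H_def by (rule order_trans[OF norm_triangle_ineq4]) (auto simp: norm_mult split: split_of_bool)
      ultimately show ?thesis by (subst integral_past_times_next) auto
    qed
    have intGH: "integrable M (\<lambda>\<omega>. G (Nrec X \<delta> n \<omega>) (runmax X n \<omega>) * H (X (Suc n) \<omega>))"
    proof -
      have "(\<lambda>\<omega>. G (Nrec X \<delta> n \<omega>) (runmax X n \<omega>) * H (X (Suc n) \<omega>))
          = (\<lambda>\<omega>. h \<omega> * of_bool (i < runmax X (Suc n) \<omega>) - h \<omega> * of_bool (i < runmax X n \<omega>))"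
        by (simp add: split fun_eq_iff)
      moreover have "integrable M (\<lambda>\<omega>. h \<omega> * of_bool (i < runmax X (Suc n) \<omega>) - h \<omega> * of_bool (i < runmax X n \<omega>))"
        by (intro Bochner_Integration.integrable_diff int) measurable
      ultimately show ?thesis by simp
    qed
    show ?case unfolding split
      by (subst Bochner_Integration.integral_add[OF int intGH]) (use Suc GH in auto)
  qed
  \<comment> \<open>Only the event that no observation up to time \<open>n\<close> exceeds
    \<open>i\<close> remains; its probability decays geometrically.\<close>
  have "norm (expectation h) \<le> B * (1 - ytail p i) ^ n" for n
  proof -
    have "expectation h = expectation (\<lambda>\<omega>. h \<omega> * of_bool (i < runmax X n \<omega>) + h \<omega> * of_bool (runmax X n \<omega> \<le> i))"
      by (intro Bochner_Integration.integral_cong) auto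
    also have "\<dots> = expectation (\<lambda>\<omega>. h \<omega> * of_bool (runmax X n \<omega> \<le> i))"
      by (subst Bochner_Integration.integral_add) (auto intro!: int simp: zero)
    also have "norm \<dots> \<le> expectation (\<lambda>\<omega>. norm (h \<omega> * of_bool (runmax X n \<omega> \<le> i)))"
      by (rule integral_norm_bound)
    also have "\<dots> \<le> expectation (\<lambda>\<omega>. B * of_bool (runmax X n \<omega> \<le> i))"
      using h_le B by (intro integral_mono integrable_norm int Bochner_Integration.integrable_mult_right
          expectation_of_bool) (auto split: split_of_bool)
    also have "\<dots> = B * (1 - ytail p i) ^ n"
      by (simp add: expectation_of_bool prob_runmax_le)
    finally show ?thesis .
  qed
  moreover have "(\<lambda>n. B * (1 - ytail p i) ^ n) \<longlonglongrightarrow> B * 0"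
  proof (intro tendsto_mult tendsto_const LIMSEQ_power_zero)
    have "0 < p i" "ytail p i + p i \<le> 1"
      using ppos[of i] sum_nonneg[of "{..<i}" p] ppos by (auto simp: ytail_eq lessThan_Suc_atMost[symmetric] less_imp_le)
    then show "norm (1 - ytail p i) < 1" using ytail_pos[of i] by simp
  qed
  ultimately have "norm (expectation h) \<le> 0"
    by (intro LIMSEQ_le_const[of "\<lambda>n. B * (1 - ytail p i) ^ n" 0]) auto
  then have "expectation h = 0" by simp
  moreover have "expectation h = expectation (\<lambda>\<omega>. of_bool (k \<in> record_values X \<delta> \<omega>) * g (Drec X \<delta> i \<omega>))
      - expectation (\<lambda>\<omega>. of_real a * g (Drec X \<delta> i \<omega>))"
    unfolding h_def left_diff_distrib
    using g B a by (intro Bochner_Integration.integral_diff integrable_const_bound[of _ B])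
      (auto simp: norm_mult split: split_of_bool intro!: mult_left_le_one_le order_trans[OF mult_left_le_one_le])
  ultimately show ?thesis by (simp add: k_def a_def)
qed

definition phi :: "real \<Rightarrow> nat \<Rightarrow> complex" where
  "phi u m = expectation (\<lambda>\<omega>. iexp (u * Drec X \<delta> m \<omega>))"

lemma integrable_iexp_Drec: "integrable M (\<lambda>\<omega>. iexp (u * Drec X \<delta> m \<omega>))"
  for u :: real
  by (rule integrable_const_bound[of _ 1]) auto

lemma norm_phi_le: "norm (phi u m) \<le> 1"
  unfolding phi_def by (rule order_trans[OF integral_norm_bound]) (simp add: prob_space)

lemma phi_small: "m \<le> \<delta> \<Longrightarrow> phi u m = 1"
  by (simp add: phi_def Drec_small prob_space)

text \<open>The exponential changes only if \<open>Suc (i + \<delta>)\<close> is a record value, and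
  then the count at \<open>i + \<delta>\<close> equals the count at \<open>i\<close> by
  \<open>Drec_before_record\<close>. The count at \<open>i\<close> decouples from that event by
  \<open>record_decoupling\<close>.\<close>

lemma phi_recursion:
  "phi u (Suc (i + \<delta>)) = phi u (i + \<delta>) + (iexp u - 1) * of_real (sk p \<delta> (Suc i)) * phi u i"
proof -
  have "iexp (u * Drec X \<delta> (Suc (i + \<delta>)) \<omega>) = iexp (u * Drec X \<delta> (i + \<delta>) \<omega>)
      + (iexp u - 1) * (of_bool (Suc (i + \<delta>) \<in> record_values X \<delta> \<omega>) * iexp (u * Drec X \<delta> i \<omega>))" for \<omega>
    using Drec_before_record[of i \<delta> X \<omega>]
    by (auto simp: Drec_Suc algebra_simps split: split_of_bool simp flip: exp_add)
  then have "phi u (Suc (i + \<delta>)) = expectation (\<lambda>\<omega>. iexp (u * Drec X \<delta> (i + \<delta>) \<omega>)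
      + (iexp u - 1) * (of_bool (Suc (i + \<delta>) \<in> record_values X \<delta> \<omega>) * iexp (u * Drec X \<delta> i \<omega>)))"
    by (simp only: phi_def)
  also have "\<dots> = phi u (i + \<delta>) + expectation (\<lambda>\<omega>. (iexp u - 1) *
      (of_bool (Suc (i + \<delta>) \<in> record_values X \<delta> \<omega>) * iexp (u * Drec X \<delta> i \<omega>)))"
    unfolding phi_def
    by (intro Bochner_Integration.integral_add integrable_iexp_Drec
        Bochner_Integration.integrable_mult_right integrable_const_bound[of _ 1])
       (auto split: split_of_bool)
  also have "\<dots> = phi u (i + \<delta>) + (iexp u - 1) * of_real (sk p \<delta> (Suc i)) * phi u i"
    using record_decoupling[of "\<lambda>a. iexp (u * a)" 1 i] by (simp add: phi_def)
  finally show ?thesis .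
qed

lemma prob_record: "prob {\<omega> \<in> space M. Suc (i + \<delta>) \<in> record_values X \<delta> \<omega>} = sk p \<delta> (Suc i)"
proof -
  have "complex_of_real (prob {\<omega> \<in> space M. Suc (i + \<delta>) \<in> record_values X \<delta> \<omega>})
      = complex_of_real (sk p \<delta> (Suc i))"
    using record_decoupling[of "\<lambda>_. 1" 1 i] by (simp add: expectation_of_bool prob_space)
  then show ?thesis by (simp only: of_real_eq_iff)
qed

text \<open>The weaker bound by \<open>rk\<close> also covers the values up to
  \<open>\<delta>\<close>, and unlike \<open>sk\<close> it can be summed through a telescoping
  logarithm.\<close>

lemma prob_record_le: "prob {\<omega> \<in> space M. k \<in> record_values X \<delta> \<omega>} \<le> rk p k"
proof (cases "k \<le> \<delta>")
  case True
  then have "{\<omega> \<in> space M. k \<in> record_values X \<delta> \<omega>} = {}"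
    using record_values_gt[of k X \<delta>] by fastforce
  then show ?thesis using rk_pos[of k] by (simp only: measure_empty less_imp_le)
next
  case False
  then obtain i where "k = Suc (i + \<delta>)" by (metis add.commute less_imp_Suc_add not_le)
  then show ?thesis using prob_record[of i] sk_le_rk[of \<delta> "Suc i"] by simp
qed

section \<open>Record values in a window and the passage from \<open>Nrec\<close> to
  \<open>Drec\<close>\<close>

lemma Drec_increment:
  assumes "l \<le> h"
  shows "integrable M (\<lambda>\<omega>. real (Drec X \<delta> h \<omega>) - real (Drec X \<delta> l \<omega>))"
    and "expectation (\<lambda>\<omega>. real (Drec X \<delta> h \<omega>) - real (Drec X \<delta> l \<omega>)) \<le> (\<Sum>k\<in>{l<..h}. rk p k)"
proof -
  have eq: "real (Drec X \<delta> h \<omega>) - real (Drec X \<delta> l \<omega>)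
      = (\<Sum>k\<in>{l<..h}. of_bool (k \<in> record_values X \<delta> \<omega>))" for \<omega>
    using assms
  proof (induction rule: dec_induct)
    case (step n)
    have "{l<..Suc n} = insert (Suc n) {l<..n}" using step by auto
    then show ?case using step by (simp add: Drec_Suc)
  qed simp
  show "integrable M (\<lambda>\<omega>. real (Drec X \<delta> h \<omega>) - real (Drec X \<delta> l \<omega>))"
    unfolding eq by (intro Bochner_Integration.integrable_sum expectation_of_bool) measurable
  show "expectation (\<lambda>\<omega>. real (Drec X \<delta> h \<omega>) - real (Drec X \<delta> l \<omega>)) \<le> (\<Sum>k\<in>{l<..h}. rk p k)"
    unfolding eq
    by (subst Bochner_Integration.integral_sum)
       (auto simp: expectation_of_bool intro!: sum_mono prob_record_le)
qed

lemma rk_le_ln: "rk p k \<le> ln (yprev p k) - ln (ytail p k)"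
proof -
  have "ln (1 - rk p k) \<le> - rk p k" using ln_le_minus_one[of "1 - rk p k"] rk_less_1[of k] by simp
  then show ?thesis using ytail_pos[of k] yprev_pos[of k] by (simp add: one_minus_rk ln_div)
qed

text \<open>The bounds of \<open>rk_le_ln\<close> telescope. The last term is estimated by 1
  instead, so that the result involves \<open>yprev p h\<close> rather than
  \<open>ytail p h\<close>: at \<open>h = mt p t\<close> only the former has a lower bound in terms
  of \<open>t\<close>.\<close>

lemma sum_rk_le:
  assumes "l < h"
  shows "(\<Sum>k\<in>{l<..h}. rk p k) \<le> 1 + (ln (ytail p l) - ln (yprev p h))"
proof -
  have "(\<Sum>k\<in>{l<..<h}. rk p k) \<le> ln (ytail p l) - ln (yprev p h)"
    using Suc_leI[OF assms]
  proof (induction rule: dec_induct)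
    case base
    have "{l<..<Suc l} = {}" by auto
    then show ?case by (simp add: yprev_def)
  next
    case (step n)
    have "{l<..<Suc n} = insert n {l<..<n}" using step by auto
    then show ?case using step rk_le_ln[of n] by (simp add: yprev_def[of p "Suc n"])
  qed
  moreover have "{l<..h} = insert h {l<..<h}" using assms by auto
  ultimately show ?thesis using rk_less_1[of h] by simp
qed


lemma ytail_mt: "0 < t \<Longrightarrow> ytail p (mt p t) < 1 / t"
proof -
  assume "0 < t"
  then have "\<forall>\<^sub>F j in sequentially. ytail p j < 1 / t"
    by (intro order_tendstoD(2)[OF ytail_tendsto_0]) simp
  then have "\<exists>j. ytail p j < 1 / t" by (auto simp: eventually_sequentially)
  then show ?thesis unfolding mt_def by (rule LeastI_ex)
qed

lemma less_mt: "i < mt p t \<Longrightarrow> 1 / t \<le> ytail p i"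
  unfolding mt_def using not_less_Least by force

text \<open>This is the minimality of \<open>mt p t\<close>; if the minimum is 0, the convention
  \<open>yprev p 0 = 1\<close> gives the bound because \<open>t\<close> is at least 1.\<close>

lemma yprev_mt: "1 \<le> t \<Longrightarrow> 1 / t \<le> yprev p (mt p t)"
  by (cases "mt p t") (auto simp: yprev_def intro!: less_mt)

lemma mt_mono: "0 < s \<Longrightarrow> s \<le> t \<Longrightarrow> mt p s \<le> mt p t"
proof -
  assume st: "0 < s" "s \<le> t"
  have "ytail p (mt p t) < 1 / t" using st by (intro ytail_mt) simp
  also have "\<dots> \<le> 1 / s" using st by (simp add: frac_le)
  finally show ?thesis unfolding mt_def[of p s] by (rule Least_le)
qed

lemma mt_at_top: "filterlim (\<lambda>n. mt p (real n)) at_top sequentially"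
  unfolding filterlim_at_top
proof
  fix Z
  have "\<forall>\<^sub>F n in sequentially. 1 / real n < ytail p Z"
    by (intro order_tendstoD(2)[OF lim_1_over_n] ytail_pos)
  then show "\<forall>\<^sub>F n in sequentially. Z \<le> mt p (real n)"
    using eventually_gt_at_top[of 0]
  proof eventually_elim
    case (elim n)
    show ?case
    proof (rule ccontr)
      assume "\<not> Z \<le> mt p (real n)"
      then have "ytail p Z \<le> ytail p (mt p (real n))"
        by (intro ytail_antimono) simp
      then show False using elim ytail_mt[of "real n"] by simp
    qed
  qed
qed

text \<open>With high probability \<open>runmax X n\<close> lies between \<open>mt p (n / K)\<close> and \<open>mt p (n * K)\<close>, and the
  expected number of record values in that window is at most logarithmic in \<open>K\<close>.\<close>
lemma Nrec_close_to_Drec: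
  fixes u K :: real
  assumes n: "n \<ge> 1" and K: "K \<ge> 1"
  shows "norm (expectation (\<lambda>\<omega>. iexp (u * Nrec X \<delta> n \<omega>)) - phi u (mt p n))
    \<le> 4 / K + \<bar>u\<bar> * (1 + 2 * ln K)"
proof -
  define l where "l = mt p (n / K)"
  define m where "m = mt p n"
  define h where "h = mt p (n * K)"
  have lmh: "l \<le> m" "m \<le> h"
    using n K unfolding l_def m_def h_def by (auto intro!: mt_mono simp: field_simps)
  define W where "W \<omega> = 2 * of_bool (runmax X n \<omega> < l) + 2 * of_bool (h < runmax X n \<omega>)
    + \<bar>u\<bar> * (real (Drec X \<delta> h \<omega>) - real (Drec X \<delta> l \<omega>))" for \<omega>
  have pointwise: "norm (iexp (u * Nrec X \<delta> n \<omega>) - iexp (u * Drec X \<delta> m \<omega>)) \<le> W \<omega>" for \<omega>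
  proof (cases "l \<le> runmax X n \<omega> \<and> runmax X n \<omega> \<le> h")
    case True
    have "norm (iexp (u * Nrec X \<delta> n \<omega>) - iexp (u * Drec X \<delta> m \<omega>))
        \<le> \<bar>u\<bar> * \<bar>real (Drec X \<delta> (runmax X n \<omega>) \<omega>) - real (Drec X \<delta> m \<omega>)\<bar>"
      by (rule order_trans[OF norm_iexp_diff_le])
        (simp add: Nrec_eq_Drec flip: right_diff_distrib abs_mult)
    also have "\<dots> \<le> \<bar>u\<bar> * (real (Drec X \<delta> h \<omega>) - real (Drec X \<delta> l \<omega>))"
    proof (intro mult_left_mono)
      have "Drec X \<delta> l \<omega> \<le> Drec X \<delta> m \<omega>" "Drec X \<delta> m \<omega> \<le> Drec X \<delta> h \<omega>"
        "Drec X \<delta> l \<omega> \<le> Drec X \<delta> (runmax X n \<omega>) \<omega>" "Drec X \<delta> (runmax X n \<omega>) \<omega> \<le> Drec X \<delta> h \<omega>"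
        using True lmh by (auto intro!: Drec_mono)
      then show "\<bar>real (Drec X \<delta> (runmax X n \<omega>) \<omega>) - real (Drec X \<delta> m \<omega>)\<bar>
          \<le> real (Drec X \<delta> h \<omega>) - real (Drec X \<delta> l \<omega>)"
        by linarith
    qed simp
    finally show ?thesis using True by (simp add: W_def)
  next
    case False
    have "0 \<le> \<bar>u\<bar> * (real (Drec X \<delta> h \<omega>) - real (Drec X \<delta> l \<omega>))"
      using Drec_mono[of l h X \<delta> \<omega>] lmh by simp
    then have "2 \<le> W \<omega>" using False by (auto simp: W_def)
    moreover have "norm (iexp (u * Nrec X \<delta> n \<omega>) - iexp (u * Drec X \<delta> m \<omega>)) \<le> 2"
      by (rule order_trans[OF norm_triangle_ineq4]) simp
    ultimately show ?thesis by linarith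
  qed
  have int_Drec: "integrable M (\<lambda>\<omega>. real (Drec X \<delta> h \<omega>) - real (Drec X \<delta> l \<omega>))"
    using lmh by (intro Drec_increment) simp
  have int_low: "integrable M (\<lambda>\<omega>. 2 * of_bool (runmax X n \<omega> < l) :: real)"
    and int_high: "integrable M (\<lambda>\<omega>. 2 * of_bool (h < runmax X n \<omega>) :: real)"
    by (intro Bochner_Integration.integrable_mult_right expectation_of_bool; measurable)+
  have "expectation W = 2 * prob {\<omega> \<in> space M. runmax X n \<omega> < l} + 2 * prob {\<omega> \<in> space M. h < runmax X n \<omega>}
      + \<bar>u\<bar> * expectation (\<lambda>\<omega>. real (Drec X \<delta> h \<omega>) - real (Drec X \<delta> l \<omega>))"
    unfolding W_def using int_low int_high int_Drec
    by (subst Bochner_Integration.integral_add, simp, simp)+ (simp add: expectation_of_bool)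
  also have "\<dots> \<le> 2 * (1 / K) + 2 * (1 / K) + \<bar>u\<bar> * (1 + 2 * ln K)"
  proof (intro add_mono mult_left_mono)
    show "prob {\<omega> \<in> space M. runmax X n \<omega> < l} \<le> 1 / K"
    proof (cases l)
      case 0
      then show ?thesis using K by simp
    next
      case (Suc i)
      \<comment> \<open>Minimality of \<open>l = Suc i\<close> makes the tail at \<open>i\<close> at
        least \<open>K / n\<close>, so the probability of staying at or below \<open>i\<close> for
        \<open>n\<close> observations is at most \<open>exp (- K)\<close>.\<close>
      have y: "K / n \<le> ytail p i" using less_mt[of i "n / K"] Suc by (simp add: l_def)
      have "prob {\<omega> \<in> space M. runmax X n \<omega> < l} = (1 - ytail p i) ^ n"
        by (simp add: Suc less_Suc_eq_le prob_runmax_le)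
      also have "\<dots> \<le> exp (- ytail p i) ^ n"
      proof (rule power_mono)
        show "1 - ytail p i \<le> exp (- ytail p i)" using exp_ge_add_one_self[of "- ytail p i"] by simp
        show "0 \<le> 1 - ytail p i" unfolding ytail_eq by (simp add: sum_nonneg ppos less_imp_le)
      qed
      also have "\<dots> = exp (- (n * ytail p i))" by (simp flip: exp_of_nat_mult)
      also have "\<dots> \<le> exp (- K)" using y n by (simp add: field_simps)
      also have "\<dots> \<le> 1 / K"
      proof -
        have "K \<le> exp K" using exp_ge_add_one_self[of K] by linarith
        then show ?thesis using K by (simp add: exp_minus field_simps)
      qed
      finally show ?thesis .
    qed
    have "prob {\<omega> \<in> space M. h < runmax X n \<omega>} \<le> n * ytail p h" by (rule prob_runmax_gt)
    also have "\<dots> \<le> n * (1 / (n * K))"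
      using ytail_mt[of "n * K"] n K by (intro mult_left_mono) (auto simp: h_def)
    also have "\<dots> = 1 / K" using n by simp
    finally show "prob {\<omega> \<in> space M. h < runmax X n \<omega>} \<le> 1 / K" .
    have "expectation (\<lambda>\<omega>. real (Drec X \<delta> h \<omega>) - real (Drec X \<delta> l \<omega>)) \<le> (\<Sum>k\<in>{l<..h}. rk p k)"
      using lmh by (intro Drec_increment) simp
    also have "\<dots> \<le> 1 + 2 * ln K"
    proof (cases "l < h")
      case True
      \<comment> \<open>Across the window the tail falls from below \<open>K / n\<close> to no less
        than \<open>1 / (n * K)\<close> before its last level, which gives the logarithmic length
        \<open>2 * ln K\<close>.\<close>
      have "ln (ytail p l) \<le> ln (K / n)"
        using ytail_mt[of "n / K"] n K ytail_pos[of l] by (simp add: l_def)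
      moreover have "ln (1 / (n * K)) \<le> ln (yprev p h)"
        unfolding h_def using n K mult_mono[of 1 "real n" 1 K] by (intro ln_mono yprev_mt) auto
      moreover have "ln (K / n) - ln (1 / (n * K)) = 2 * ln K"
        using n K by (simp add: ln_div ln_mult)
      ultimately show ?thesis using sum_rk_le[OF True] by linarith
    qed (use K in simp)
    finally show "expectation (\<lambda>\<omega>. real (Drec X \<delta> h \<omega>) - real (Drec X \<delta> l \<omega>)) \<le> 1 + 2 * ln K" .
  qed auto
  finally have EW: "expectation W \<le> 4 / K + \<bar>u\<bar> * (1 + 2 * ln K)" by simp
  have int_N: "integrable M (\<lambda>\<omega>. iexp (u * Nrec X \<delta> n \<omega>))"
    by (rule integrable_const_bound[of _ 1]) auto
  have "norm (expectation (\<lambda>\<omega>. iexp (u * Nrec X \<delta> n \<omega>)) - phi u m)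
      = norm (expectation (\<lambda>\<omega>. iexp (u * Nrec X \<delta> n \<omega>) - iexp (u * Drec X \<delta> m \<omega>)))"
    unfolding phi_def
    by (intro arg_cong[where f = norm] Bochner_Integration.integral_diff[symmetric] int_N integrable_iexp_Drec)
  also have "\<dots> \<le> expectation (\<lambda>\<omega>. norm (iexp (u * Nrec X \<delta> n \<omega>) - iexp (u * Drec X \<delta> m \<omega>)))"
    by (rule integral_norm_bound)
  also have "\<dots> \<le> expectation W"
  proof (intro integral_mono pointwise integrable_norm Bochner_Integration.integrable_diff int_N integrable_iexp_Drec)
    show "integrable M W"
      unfolding W_def
      by (intro Bochner_Integration.integrable_add Bochner_Integration.integrable_mult_right int_low int_high int_Drec)
  qed
  finally show ?thesis using EW by (simp add: m_def)
qed

end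

section \<open>The central limit theorem\<close>

context record_model
begin

section \<open>Convergence of the characteristic functions of the normalised counts\<close>

lemma ek_tendsto:
  assumes "rk p \<longlonglongrightarrow> r"
  shows "ek p d \<longlonglongrightarrow> (1 - r) ^ d"
proof -
  have "(\<lambda>k. \<Prod>j<d. 1 - rk p (k + j)) \<longlonglongrightarrow> (\<Prod>j<d. 1 - r)"
    using assms by (intro tendsto_prod tendsto_diff tendsto_const LIMSEQ_ignore_initial_segment)
  moreover have "ek p d k = (\<Prod>j<d. 1 - rk p (k + j))" for k
    using prod.shift_bounds_nat_ivl[of "\<lambda>j. 1 - rk p j" 0 k d]
    by (simp add: ek_def add.commute atLeast0LessThan)
  ultimately have "(\<lambda>k. ek p d k) \<longlonglongrightarrow> (1 - r) ^ d" by simp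
  then show ?thesis .
qed

lemma sk_tendsto:
  assumes "rk p \<longlonglongrightarrow> r"
  shows "sk p d \<longlonglongrightarrow> r * (1 - r) ^ d"
  unfolding sk_eq using assms by (intro tendsto_mult ek_tendsto LIMSEQ_ignore_initial_segment)

text \<open>The term at index 0 is split off because the recursion starts with
  \<open>sk p \<delta> 1\<close>: a record value must exceed \<open>\<delta>\<close>, so the value
  \<open>\<delta>\<close> itself never contributes.\<close>

lemma theta_eq: "theta p d m = sk p d 0 + (\<Sum>i<m. sk p d (Suc i))"
  unfolding theta_def lessThan_Suc_atMost[symmetric] by (rule sum.lessThan_Suc_shift)

text \<open>The norming \<open>B\<close> is left general so that both normalisations of the theorem
  are covered. With \<open>u n = t / B n\<close>, the Gaussian expansion treats \<open>phi\<close>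
  at level \<open>mt p n\<close>, and \<open>Nrec_close_to_Drec\<close> then transfers the limit to
  \<open>Nrec\<close>.\<close>

lemma Nrec_char_tendsto:
  fixes B :: "nat \<Rightarrow> real" and r \<kappa> t :: real
  assumes r: "rk p \<longlonglongrightarrow> r" and B: "filterlim B at_top sequentially"
    and theta: "filterlim (theta p \<delta>) at_top sequentially"
    and ratio: "(\<lambda>n. theta p \<delta> (mt p n) / (B n)\<^sup>2) \<longlonglongrightarrow> \<kappa>"
  shows "(\<lambda>n. expectation (\<lambda>\<omega>. iexp (t * ((Nrec X \<delta> n \<omega> - theta p \<delta> (mt p n)) / B n))))
    \<longlonglongrightarrow> of_real (exp (- (t\<^sup>2) / 2 * (\<kappa> * (1 - (2 * real \<delta> + 1) * (r * (1 - r) ^ \<delta>)))))"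
proof -
  define a where "a = r * (1 - r) ^ \<delta>"
  define v where "v = 1 - (2 * real \<delta> + 1) * a"
  define x where "x i = sk p \<delta> (Suc i)" for i
  define b where "b i = (\<Sum>j\<in>{i - \<delta>..<i}. x j)" for i
  define S where "S m = (\<Sum>i<m. x i)" for m
  define V where "V m = (\<Sum>i<m. x i * (1 - x i - 2 * b i))" for m
  define u where "u n = t / B n" for n
  \<comment> \<open>The recursion is applied to the sequence \<open>phi u (i + \<delta>)\<close>,
    which starts at 1, so level \<open>mt p n\<close> has index \<open>mt p n - \<delta>\<close>.
    Truncation is harmless because \<open>phi\<close> equals 1 at all levels up to
    \<open>\<delta>\<close>.\<close>
  define j where "j n = mt p (real n) - \<delta>" for n
  have x: "0 \<le> x i" "x i \<le> 1" for i
    using sk_pos[of \<delta> "Suc i"] sk_le_1 by (auto simp: x_def)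
  have x_lim: "x \<longlonglongrightarrow> a"
    unfolding x_def a_def using sk_tendsto[OF r] by (rule LIMSEQ_Suc)
  have theta_S: "theta p \<delta> m = sk p \<delta> 0 + S m" for m
    by (simp add: theta_eq S_def x_def)
  have S_mono: "mono S"
    unfolding S_def by (intro incseq_SucI) (simp add: x)
  have S_top: "filterlim S at_top sequentially"
  proof (rule filterlim_at_top_mono)
    show "filterlim (\<lambda>m. - 1 + theta p \<delta> m) at_top sequentially"
      by (intro filterlim_tendsto_add_at_top[OF tendsto_const theta])
    show "\<forall>\<^sub>F m in sequentially. - 1 + theta p \<delta> m \<le> S m"
      using sk_le_1[of \<delta> 0] by (simp add: theta_S)
  qed
  have u_lim: "u \<longlonglongrightarrow> 0"
    unfolding u_def using B by (intro real_tendsto_divide_at_top[OF tendsto_const])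
  have j_top: "filterlim j at_top sequentially"
    unfolding j_def by (rule filterlim_compose[OF _ mt_at_top]) (rule filterlim_minus_const_nat_at_top)
  \<comment> \<open>The two sums differ by the initial term and at most \<open>\<delta>\<close>
    final terms, each at most 1.\<close>
  have gap: "\<bar>theta p \<delta> (mt p n) - S (j n)\<bar> \<le> 1 + \<delta>" for n
  proof -
    have "S (mt p n) - S (j n) = (\<Sum>i\<in>{j n..<mt p n}. x i)"
      unfolding S_def j_def by (simp add: sum_diff_nat_ivl flip: atLeast0LessThan)
    also have "\<dots> \<le> (\<Sum>i\<in>{j n..<mt p n}. 1)" by (intro sum_mono x)
    also have "\<dots> \<le> \<delta>" by (simp add: j_def)
    finally have "S (mt p n) - S (j n) \<le> \<delta>" .
    moreover have "S (j n) \<le> S (mt p n)" using S_mono by (auto simp: mono_def j_def)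
    ultimately show ?thesis
      using sk_pos[of \<delta> 0] sk_le_1[of \<delta> 0] by (auto simp: theta_S)
  qed
  have uS: "(\<lambda>n. (u n)\<^sup>2 * S (j n)) \<longlonglongrightarrow> t\<^sup>2 * \<kappa>"
  proof -
    have "(\<lambda>n. t\<^sup>2 * (theta p \<delta> (mt p n) / (B n)\<^sup>2)) \<longlonglongrightarrow> t\<^sup>2 * \<kappa>"
      by (intro tendsto_mult tendsto_const ratio)
    then have "(\<lambda>n. (u n)\<^sup>2 * theta p \<delta> (mt p n)) \<longlonglongrightarrow> t\<^sup>2 * \<kappa>"
      by (simp add: u_def power_divide)
    moreover have "(\<lambda>n. (u n)\<^sup>2 * (theta p \<delta> (mt p n) - S (j n))) \<longlonglongrightarrow> 0"
    proof (rule Lim_null_comparison)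
      show "(\<lambda>n. (u n)\<^sup>2 * (1 + \<delta>)) \<longlonglongrightarrow> 0"
        using tendsto_mult[OF tendsto_power[OF u_lim, of 2] tendsto_const[of "1 + real \<delta>"]] by simp
      show "\<forall>\<^sub>F n in sequentially. norm ((u n)\<^sup>2 * (theta p \<delta> (mt p n) - S (j n))) \<le> (u n)\<^sup>2 * (1 + \<delta>)"
        using gap by (intro always_eventually) (simp add: abs_mult mult_left_mono)
    qed
    ultimately show ?thesis
      by (rule Lim_transform2[OF _ Lim_transform_eventually]) (auto simp: algebra_simps)
  qed
  have uV: "(\<lambda>n. (u n)\<^sup>2 * V (j n)) \<longlonglongrightarrow> t\<^sup>2 * \<kappa> * v"
  proof -
    \<comment> \<open>The window sum \<open>b\<close> tends to \<open>\<delta> * a\<close>, so the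
      variance per unit of \<open>x\<close> tends to \<open>v\<close>; weighted averaging turns this
      into the limit of \<open>V / S\<close>.\<close>
    have "(\<lambda>i. \<Sum>k<\<delta>. x (i + k)) \<longlonglongrightarrow> (\<Sum>k<\<delta>. a)"
      using x_lim by (intro tendsto_sum LIMSEQ_ignore_initial_segment)
    moreover have "b (i + \<delta>) = (\<Sum>k<\<delta>. x (i + k))" for i
      using sum.shift_bounds_nat_ivl[of x 0 i \<delta>]
      by (simp add: b_def add.commute atLeast0LessThan)
    ultimately have "b \<longlonglongrightarrow> \<delta> * a"
      by (intro LIMSEQ_offset[of b \<delta>]) simp
    then have "(\<lambda>i. 1 - x i - 2 * b i) \<longlonglongrightarrow> 1 - a - 2 * (\<delta> * a)"
      by (intro tendsto_intros x_lim)
    then have "(\<lambda>m. V m / S m) \<longlonglongrightarrow> 1 - a - 2 * (\<delta> * a)"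
      unfolding V_def S_def using S_top[unfolded S_def] x
      by (subst mult.commute) (intro weighted_cesaro)
    then have "(\<lambda>n. V (j n) / S (j n)) \<longlonglongrightarrow> v"
      using filterlim_compose[OF _ j_top] by (force simp: v_def algebra_simps)
    with uS have "(\<lambda>n. (u n)\<^sup>2 * S (j n) * (V (j n) / S (j n))) \<longlonglongrightarrow> t\<^sup>2 * \<kappa> * v"
      by (rule tendsto_mult)
    moreover have "\<forall>\<^sub>F n in sequentially. S (j n) > 0"
      using filterlim_compose[OF S_top j_top] by (auto simp: filterlim_at_top_dense)
    then have "\<forall>\<^sub>F n in sequentially. (u n)\<^sup>2 * S (j n) * (V (j n) / S (j n)) = (u n)\<^sup>2 * V (j n)"
      by eventually_elim simp
    ultimately show ?thesis by (rule Lim_transform_eventually)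
  qed
  have phi_eq: "phi w m = phi w (m - \<delta> + \<delta>)" for w m
    by (cases "m \<le> \<delta>") (simp_all add: phi_small)
  obtain C where C: "\<And>(f :: nat \<Rightarrow> complex) (x :: nat \<Rightarrow> real) (u :: real) m.
      \<lbrakk>\<bar>u\<bar> \<le> 1; \<And>i. 0 \<le> x i; \<And>i. x i \<le> 1; \<And>i. norm (f i) \<le> 1; f 0 = 1;
      \<And>i. f (Suc i) = f i + (iexp u - 1) * of_real (x i) * f (i - \<delta>)\<rbrakk> \<Longrightarrow>
      norm (f m * iexp (- u * (\<Sum>i<m. x i))
        - of_real (exp (- u\<^sup>2 / 2 * (\<Sum>i<m. x i * (1 - x i - 2 * (\<Sum>j\<in>{i - \<delta>..<i}. x j))))))
      \<le> C * \<bar>u\<bar> * (u\<^sup>2 * (\<Sum>i<m. x i)) * exp (2 * (1 + \<delta>) * (u\<^sup>2 * (\<Sum>i<m. x i)))"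
    using delayed_recursion_gaussian[of \<delta>] by blast
  have "(\<lambda>n. phi (u n) (mt p n) * iexp (- u n * S (j n)) - of_real (exp (- (u n)\<^sup>2 / 2 * V (j n)))) \<longlonglongrightarrow> 0"
  proof (rule Lim_null_comparison)
    have "\<forall>\<^sub>F n in sequentially. \<bar>u n\<bar> < 1"
      using order_tendstoD(2)[OF tendsto_rabs_zero[OF u_lim], of 1] by simp
    then show "\<forall>\<^sub>F n in sequentially.
        norm (phi (u n) (mt p n) * iexp (- u n * S (j n)) - of_real (exp (- (u n)\<^sup>2 / 2 * V (j n))))
        \<le> C * \<bar>u n\<bar> * ((u n)\<^sup>2 * S (j n)) * exp (2 * (1 + \<delta>) * ((u n)\<^sup>2 * S (j n)))"
    proof eventually_elim
      case (elim n)
      have "phi (u n) (Suc i + \<delta>) = phi (u n) (i + \<delta>)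
          + (iexp (u n) - 1) * of_real (x i) * phi (u n) (i - \<delta> + \<delta>)" for i
        using phi_recursion[of "u n" i] phi_eq[of "u n" i] by (simp add: x_def)
      then show ?case
        using C[of "u n" x "\<lambda>i. phi (u n) (i + \<delta>)" "j n"] elim x norm_phi_le phi_small
        unfolding S_def V_def b_def by (simp add: phi_eq[of "u n" "mt p n"] j_def)
    qed
    have "(\<lambda>n. C * \<bar>u n\<bar> * ((u n)\<^sup>2 * S (j n)) * exp (2 * (1 + \<delta>) * ((u n)\<^sup>2 * S (j n))))
        \<longlonglongrightarrow> C * 0 * (t\<^sup>2 * \<kappa>) * exp (2 * (1 + \<delta>) * (t\<^sup>2 * \<kappa>))"
      by (intro tendsto_intros uS tendsto_rabs_zero u_lim)
    then show "(\<lambda>n. C * \<bar>u n\<bar> * ((u n)\<^sup>2 * S (j n)) * exp (2 * (1 + \<delta>) * ((u n)\<^sup>2 * S (j n))))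
        \<longlonglongrightarrow> 0" by simp
  qed
  moreover have "(\<lambda>n. complex_of_real (exp (- ((u n)\<^sup>2 * V (j n)) / 2))) \<longlonglongrightarrow> of_real (exp (- (t\<^sup>2 * \<kappa> * v) / 2))"
    by (intro tendsto_intros uV) simp
  then have "(\<lambda>n. complex_of_real (exp (- (u n)\<^sup>2 / 2 * V (j n)))) \<longlonglongrightarrow> of_real (exp (- (t\<^sup>2 * \<kappa> * v) / 2))"
    by simp
  ultimately have "(\<lambda>n. phi (u n) (mt p n) * iexp (- u n * S (j n))) \<longlonglongrightarrow> of_real (exp (- (t\<^sup>2 * \<kappa> * v) / 2))"
    using tendsto_add by fastforce
  moreover have "(\<lambda>n. expectation (\<lambda>\<omega>. iexp (t * ((Nrec X \<delta> n \<omega> - theta p \<delta> (mt p n)) / B n)))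
      - phi (u n) (mt p n) * iexp (- u n * S (j n))) \<longlonglongrightarrow> 0"
  proof (rule Lim_null_comparison)
    \<comment> \<open>The window parameter is taken as \<open>K = B n\<close>: then
      \<open>4 / K\<close> vanishes, and \<open>\<bar>u n\<bar> * ln K\<close> is
      \<open>\<bar>t\<bar> * ln (B n) / B n\<close>, which vanishes too.\<close>
    have "\<forall>\<^sub>F n in sequentially. n \<ge> 1 \<and> B n \<ge> 1"
      using B by (intro eventually_conj eventually_ge_at_top) (auto simp: filterlim_at_top)
    then show "\<forall>\<^sub>F n in sequentially.
        norm (expectation (\<lambda>\<omega>. iexp (t * ((Nrec X \<delta> n \<omega> - theta p \<delta> (mt p n)) / B n)))
          - phi (u n) (mt p n) * iexp (- u n * S (j n)))
        \<le> 4 / B n + \<bar>t\<bar> * (1 / B n + 2 * (ln (B n) / B n)) + \<bar>t\<bar> * (1 + \<delta>) / B n"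
    proof eventually_elim
      case (elim n)
      define \<theta> where "\<theta> = theta p \<delta> (mt p n)"
      have "iexp (t * ((Nrec X \<delta> n \<omega> - \<theta>) / B n)) = iexp (- u n * \<theta>) * iexp (u n * Nrec X \<delta> n \<omega>)" for \<omega>
        by (simp add: u_def diff_divide_distrib algebra_simps flip: exp_add)
      then have "expectation (\<lambda>\<omega>. iexp (t * ((Nrec X \<delta> n \<omega> - \<theta>) / B n)))
          = iexp (- u n * \<theta>) * expectation (\<lambda>\<omega>. iexp (u n * Nrec X \<delta> n \<omega>))"
        by (simp only: integral_mult_right_zero)
      then have "expectation (\<lambda>\<omega>. iexp (t * ((Nrec X \<delta> n \<omega> - \<theta>) / B n)))
            - phi (u n) (mt p n) * iexp (- u n * S (j n))
          = iexp (- u n * \<theta>) * (expectation (\<lambda>\<omega>. iexp (u n * Nrec X \<delta> n \<omega>)) - phi (u n) (mt p n))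
            + phi (u n) (mt p n) * (iexp (- u n * \<theta>) - iexp (- u n * S (j n)))"
        by (simp only: algebra_simps)
      also have "norm \<dots> \<le> 1 * (4 / B n + \<bar>u n\<bar> * (1 + 2 * ln (B n))) + 1 * (\<bar>u n\<bar> * (1 + \<delta>))"
      proof (rule order_trans[OF norm_triangle_ineq], intro add_mono)
        show "norm (iexp (- u n * \<theta>) * (expectation (\<lambda>\<omega>. iexp (u n * Nrec X \<delta> n \<omega>)) - phi (u n) (mt p n)))
            \<le> 1 * (4 / B n + \<bar>u n\<bar> * (1 + 2 * ln (B n)))"
          unfolding norm_mult using elim by (intro mult_mono Nrec_close_to_Drec) auto
        have "norm (iexp (- u n * \<theta>) - iexp (- u n * S (j n))) \<le> \<bar>- u n * \<theta> - - u n * S (j n)\<bar>"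
          by (rule norm_iexp_diff_le)
        also have "\<dots> = \<bar>u n\<bar> * \<bar>\<theta> - S (j n)\<bar>"
          by (simp add: abs_mult abs_minus_commute flip: right_diff_distrib)
        also have "\<dots> \<le> \<bar>u n\<bar> * (1 + \<delta>)" using gap[of n] by (intro mult_left_mono) (auto simp: \<theta>_def)
        finally show "norm (phi (u n) (mt p n) * (iexp (- u n * \<theta>) - iexp (- u n * S (j n))))
            \<le> 1 * (\<bar>u n\<bar> * (1 + \<delta>))"
          unfolding norm_mult by (intro mult_mono norm_phi_le) auto
      qed
      also have "\<dots> = 4 / B n + \<bar>t\<bar> * (1 / B n + 2 * (ln (B n) / B n)) + \<bar>t\<bar> * (1 + \<delta>) / B n"
        using elim by (simp add: u_def field_simps)
      finally show ?case by (simp add: \<theta>_def)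
    qed
    have inv: "((\<lambda>y. c / y) \<longlongrightarrow> 0) at_top" for c :: real
      by (rule real_tendsto_divide_at_top[OF tendsto_const filterlim_ident])
    have "((\<lambda>y. 4 / y + \<bar>t\<bar> * (1 / y + 2 * (ln y / y)) + \<bar>t\<bar> * (1 + \<delta>) / y) \<longlongrightarrow> 0 + \<bar>t\<bar> * (0 + 2 * 0) + 0) at_top"
      by (intro tendsto_add tendsto_mult tendsto_const inv ln_x_over_x_tendsto_0)
    then have "((\<lambda>y. 4 / y + \<bar>t\<bar> * (1 / y + 2 * (ln y / y)) + \<bar>t\<bar> * (1 + \<delta>) / y) \<longlongrightarrow> 0) at_top"
      by simp
    from filterlim_compose[OF this B]
    show "(\<lambda>n. 4 / B n + \<bar>t\<bar> * (1 / B n + 2 * (ln (B n) / B n)) + \<bar>t\<bar> * (1 + \<delta>) / B n) \<longlonglongrightarrow> 0" .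
  qed
  ultimately have "(\<lambda>n. expectation (\<lambda>\<omega>. iexp (t * ((Nrec X \<delta> n \<omega> - theta p \<delta> (mt p n)) / B n))))
      \<longlonglongrightarrow> of_real (exp (- (t\<^sup>2 * \<kappa> * v) / 2))"
    by (rule Lim_transform)
  then show ?thesis by (simp add: v_def a_def mult.assoc)
qed

end

section \<open>The limiting normal law and positivity of its variance\<close>

lemma char_normal_dist:
  assumes "0 < v"
  shows "char (normal_dist v) t = of_real (exp (- (t\<^sup>2) / 2 * v))"
proof -
  define \<sigma> where "\<sigma> = sqrt v"
  have \<sigma>: "0 < \<sigma>" "\<sigma>\<^sup>2 = v" using assms by (auto simp: \<sigma>_def)
  define N where "N = density lborel (normal_density 0 \<sigma>)"
  interpret N: prob_space N unfolding N_def using \<sigma> by (intro prob_space_normal_density) simp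
  have [measurable_cong]: "sets N = sets borel" by (simp add: N_def)
  have "distr N lborel (\<lambda>x. x) = density lborel (normal_density 0 \<sigma>)"
    unfolding N_def by (rule distr_id2) simp
  then have "distributed N lborel (\<lambda>x. x) (normal_density 0 \<sigma>)"
    by (simp add: distributed_def)
  then have "distributed N lborel (\<lambda>x. (x - 0) / \<sigma>) std_normal_density"
    using N.normal_standard_normal_convert[OF \<sigma>(1), of "\<lambda>x. x" 0] by simp
  then have D: "distr N lborel (\<lambda>x. x / \<sigma>) = std_normal_distribution"
    by (simp add: distributed_def)
  have "of_real (exp (- ((\<sigma> * t)\<^sup>2) / 2)) = char (distr N lborel (\<lambda>x. x / \<sigma>)) (\<sigma> * t)"
    unfolding D by (simp add: char_std_normal_distribution)
  also have "\<dots> = (CLINT x|N. iexp (\<sigma> * t * (x / \<sigma>)))"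
    unfolding char_def by (subst integral_distr) auto
  also have "\<dots> = char N t"
    unfolding char_def using \<sigma> by (intro Bochner_Integration.integral_cong) (auto simp: mult.assoc)
  finally show ?thesis
    using assms \<sigma> by (simp add: normal_dist_def N_def \<sigma>_def power_mult_distrib mult.commute)
qed

lemma real_distribution_normal_dist: "0 < v \<Longrightarrow> real_distribution (normal_dist v)"
  unfolding normal_dist_def real_distribution_def real_distribution_axioms_def
  by (auto intro!: prob_space_normal_density)

text \<open>The polynomial consists of the first three terms of the binomial series of
  \<open>(1 - r)\<close> to the power \<open>- d\<close>. In the induction, multiplying the
  polynomial for \<open>Suc d\<close> by \<open>1 - r\<close> returns the one for \<open>d\<close>
  minus a nonnegative cubic term.\<close>

lemma quadratic_bernoulli:
  fixes r :: real
  assumes "0 \<le> r" "r \<le> 1"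
  shows "(1 + real d * r + real d * (real d + 1) / 2 * r\<^sup>2) * (1 - r) ^ d \<le> 1"
proof (induction d)
  case (Suc d)
  have "(1 + real (Suc d) * r + real (Suc d) * (real (Suc d) + 1) / 2 * r\<^sup>2) * (1 - r)
      = 1 + real d * r + real d * (real d + 1) / 2 * r\<^sup>2 - (real d + 1) * (real d + 2) / 2 * r ^ 3"
    by (simp add: field_simps power2_eq_square power3_eq_cube)
  also have "\<dots> \<le> 1 + real d * r + real d * (real d + 1) / 2 * r\<^sup>2" using assms by simp
  finally have "(1 + real (Suc d) * r + real (Suc d) * (real (Suc d) + 1) / 2 * r\<^sup>2) * (1 - r) * (1 - r) ^ d
      \<le> (1 + real d * r + real d * (real d + 1) / 2 * r\<^sup>2) * (1 - r) ^ d"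
    using assms by (intro mult_right_mono) auto
  also have "\<dots> \<le> 1" by (rule Suc)
  finally show ?case by (simp only: power_Suc mult.assoc)
qed simp

text \<open>This keeps the limit law nondegenerate. By \<open>quadratic_bernoulli\<close> it is
  enough to compare \<open>(2 * real d + 1) * r\<close> with a quadratic polynomial, and the
  difference is positive after completing the square.\<close>

lemma limit_variance_factor_pos:
  fixes r :: real
  assumes r: "0 \<le> r" "r < 1"
  shows "(2 * real d + 1) * (r * (1 - r) ^ d) < 1"
proof (cases "d = 0")
  case True
  then show ?thesis using r by simp
next
  case False
  have "0 < (1 - (d + 1) * r / 2)\<^sup>2 + (real d + 1) * (real d - 1) / 4 * r\<^sup>2"
  proof (cases "r = 0 \<or> d = 1")
    case True
    then show ?thesis using r by auto
  next
    case neq: False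
    then have "0 < (real d + 1) * (real d - 1) / 4 * r\<^sup>2" using False by simp
    then show ?thesis by (intro add_nonneg_pos) auto
  qed
  also have "\<dots> = 1 + real d * r + real d * (real d + 1) / 2 * r\<^sup>2 - (2 * real d + 1) * r"
    by (simp add: field_simps power2_eq_square)
  finally have "(2 * real d + 1) * r * (1 - r) ^ d < (1 + real d * r + real d * (real d + 1) / 2 * r\<^sup>2) * (1 - r) ^ d"
    using r by (intro mult_strict_right_mono) auto
  also have "\<dots> \<le> 1" using r by (intro quadratic_bernoulli) auto
  finally show ?thesis by (simp only: mult.assoc)
qed

text \<open>The quotient is squeezed by the inequalities
  \<open>x \<le> - ln (1 - x) \<le> x / (1 - x)\<close>. It is needed when \<open>r = 0\<close>,
  where numerator and denominator both vanish in the limit.\<close>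

lemma div_minus_ln_one_minus_tendsto:
  fixes f :: "nat \<Rightarrow> real"
  assumes f: "f \<longlonglongrightarrow> 0" and pos: "\<And>k. 0 < f k" "\<And>k. f k < 1"
  shows "(\<lambda>k. f k / - ln (1 - f k)) \<longlonglongrightarrow> 1"
proof (rule tendsto_sandwich)
  show "\<forall>\<^sub>F k in sequentially. 1 - f k \<le> f k / - ln (1 - f k)"
  proof (intro always_eventually allI)
    fix k
    have "- ln (1 - f k) = ln (1 / (1 - f k))" using pos[of k] by (simp add: ln_div)
    also have "\<dots> \<le> 1 / (1 - f k) - 1" using pos[of k] by (intro ln_le_minus_one) simp
    also have "\<dots> = f k / (1 - f k)" using pos[of k] by (simp add: field_simps)
    finally have "(1 - f k) * - ln (1 - f k) \<le> f k" using pos[of k] by (simp add: field_simps)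
    moreover have "0 < - ln (1 - f k)" using pos[of k] by simp
    ultimately show "1 - f k \<le> f k / - ln (1 - f k)" by (subst pos_le_divide_eq) auto
  qed
  show "\<forall>\<^sub>F k in sequentially. f k / - ln (1 - f k) \<le> 1"
  proof (intro always_eventually allI)
    fix k
    have "f k \<le> - ln (1 - f k)" using ln_le_minus_one[of "1 - f k"] pos[of k] by simp
    then show "f k / - ln (1 - f k) \<le> 1" using pos[of k] by (subst pos_divide_le_eq) auto
  qed
  show "(\<lambda>k. 1 - f k) \<longlonglongrightarrow> 1" using tendsto_diff[OF tendsto_const f, of 1] by simp
qed simp

section \<open>The two central limit theorems and the case of finitely many records\<close>

context record_model
begin

lemma Nrec_weak_conv:
  fixes B :: "nat \<Rightarrow> real" and r \<kappa> :: real
  assumes "rk p \<longlonglongrightarrow> r" and "filterlim B at_top sequentially"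
    and "filterlim (theta p \<delta>) at_top sequentially"
    and "(\<lambda>n. theta p \<delta> (mt p n) / (B n)\<^sup>2) \<longlonglongrightarrow> \<kappa>"
    and v: "v = \<kappa> * (1 - (2 * real \<delta> + 1) * (r * (1 - r) ^ \<delta>))" "0 < v"
  shows "weak_conv_m (\<lambda>n. distr M borel (\<lambda>\<omega>. (real (Nrec X \<delta> n \<omega>) - theta p \<delta> (mt p (real n))) / B n))
    (normal_dist v)"
proof (rule levy_continuity)
  have rv: "(\<lambda>\<omega>. (real (Nrec X \<delta> n \<omega>) - theta p \<delta> (mt p (real n))) / B n) \<in> borel_measurable M" for n
    by measurable
  then show "real_distribution (distr M borel (\<lambda>\<omega>. (real (Nrec X \<delta> n \<omega>) - theta p \<delta> (mt p (real n))) / B n))" for n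
    by (rule real_distribution_distr)
  show "real_distribution (normal_dist v)" using v by (intro real_distribution_normal_dist)
  show "(\<lambda>n. char (distr M borel (\<lambda>\<omega>. (real (Nrec X \<delta> n \<omega>) - theta p \<delta> (mt p (real n))) / B n)) t)
      \<longlonglongrightarrow> char (normal_dist v) t" for t
    using Nrec_char_tendsto[OF assms(1-4), of t, folded v(1)] rv
    by (simp add: char_def[of "distr _ _ _"] integral_distr char_normal_dist[OF v(2)])
qed

text \<open>Weighted averaging replaces the centering sums by more explicit ones; \<open>l\<close>
  will be \<open>- ln (1 - rk p (k + \<delta>))\<close> if \<open>r < 1\<close> and
  \<open>ek p \<delta> k\<close> if \<open>r = 1\<close>.\<close>

lemma theta_tendsto:
  assumes l: "\<And>k. 0 < l k" and L: "filterlim (\<lambda>m. \<Sum>k\<le>m. l k) at_top sequentially"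
    and ratio: "(\<lambda>k. sk p \<delta> k / l k) \<longlonglongrightarrow> \<kappa>"
  shows "(\<lambda>m. theta p \<delta> m / (\<Sum>k\<le>m. l k)) \<longlonglongrightarrow> \<kappa>"
    and "0 < \<kappa> \<Longrightarrow> filterlim (theta p \<delta>) at_top sequentially"
proof -
  have "filterlim (\<lambda>m. \<Sum>k<m. l k) at_top sequentially"
    by (rule filterlim_sequentially_Suc[THEN iffD1]) (use L in \<open>simp add: lessThan_Suc_atMost\<close>)
  from weighted_cesaro[OF less_imp_le[OF l] this ratio]
  have "(\<lambda>m. (\<Sum>k<m. sk p \<delta> k) / (\<Sum>k<m. l k)) \<longlonglongrightarrow> \<kappa>"
    using l by (simp add: less_imp_neq[THEN not_sym])
  from LIMSEQ_Suc[OF this] show lim: "(\<lambda>m. theta p \<delta> m / (\<Sum>k\<le>m. l k)) \<longlonglongrightarrow> \<kappa>"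
    by (simp only: theta_def lessThan_Suc_atMost)
  assume "0 < \<kappa>"
  from filterlim_tendsto_pos_mult_at_top[OF lim this L]
  have "filterlim (\<lambda>m. theta p \<delta> m / (\<Sum>k\<le>m. l k) * (\<Sum>k\<le>m. l k)) at_top sequentially" .
  moreover have "theta p \<delta> m / (\<Sum>k\<le>m. l k) * (\<Sum>k\<le>m. l k) = theta p \<delta> m" for m
    using sum_pos[of "{..m}" l] l by auto
  ultimately show "filterlim (theta p \<delta>) at_top sequentially" by simp
qed

lemma minus_ln_one_minus_rk: "- ln (1 - rk p k) = ln (yprev p k) - ln (ytail p k)"
  using ytail_pos[of k] yprev_pos[of k] by (simp add: one_minus_rk ln_div)

lemma sum_minus_ln: "(\<Sum>k\<le>m. - ln (1 - rk p (k + d))) = ln (yprev p d) - ln (ytail p (m + d))"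
  by (induction m) (simp_all add: minus_ln_one_minus_rk yprev_def[of p "Suc _"])

text \<open>The weights \<open>l\<close> telescope to a logarithm of the tail, which at level
  \<open>mt p n\<close> equals \<open>ln n\<close> up to a bounded error. Hence
  \<open>theta p \<delta> (mt p n)\<close> is asymptotic to \<open>\<kappa> * ln n\<close>.\<close>

lemma clt_of_rlim_less_1:
  assumes rlim: "rk p \<longlonglongrightarrow> r" and r: "0 \<le> r" "r < 1"
  shows "weak_conv_m (\<lambda>n. distr M borel
      (\<lambda>\<omega>. (real (Nrec X \<delta> n \<omega>) - theta p \<delta> (mt p (real n))) / sqrt (ln (real n))))
    (normal_dist (sigma_sq r \<delta>))"
proof -
  define a where "a = r * (1 - r) ^ \<delta>"
  \<comment> \<open>The value 1 at \<open>r = 0\<close> continues the other branch, since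
    \<open>r / - ln (1 - r)\<close> tends to 1 as \<open>r\<close> tends to 0.\<close>
  define \<kappa> where "\<kappa> = (if r = 0 then 1 else a / - ln (1 - r))"
  define l where "l k = - ln (1 - rk p (k + \<delta>))" for k
  define L where "L m = (\<Sum>k\<le>m. l k)" for m
  have L_eq: "L m = ln (yprev p \<delta>) - ln (ytail p (m + \<delta>))" for m
    unfolding L_def l_def by (rule sum_minus_ln)
  have l: "0 < l k" for k
    using rk_pos[of "k + \<delta>"] rk_less_1[of "k + \<delta>"] by (simp add: l_def)
  have \<kappa>: "0 < \<kappa>"
  proof (cases "r = 0")
    case False
    then have "0 < a" "0 < - ln (1 - r)" using r by (auto simp: a_def)
    then have "0 < a / - ln (1 - r)" by (rule divide_pos_pos)
    then show ?thesis using False by (simp add: \<kappa>_def)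
  qed (simp add: \<kappa>_def)
  have rshift: "(\<lambda>k. rk p (k + \<delta>)) \<longlonglongrightarrow> r"
    using rlim by (rule LIMSEQ_ignore_initial_segment)
  have ratio: "(\<lambda>k. sk p \<delta> k / l k) \<longlonglongrightarrow> \<kappa>"
  proof (cases "r = 0")
    case True
    have "(\<lambda>k. ek p \<delta> k * (rk p (k + \<delta>) / - ln (1 - rk p (k + \<delta>)))) \<longlonglongrightarrow> (1 - r) ^ \<delta> * 1"
      using rshift True rk_pos rk_less_1
      by (intro tendsto_mult ek_tendsto rlim div_minus_ln_one_minus_tendsto) auto
    then show ?thesis using True by (simp add: \<kappa>_def l_def sk_eq mult.commute)
  next
    case False
    then have "- ln (1 - r) \<noteq> 0" using r by simp
    moreover have "l \<longlonglongrightarrow> - ln (1 - r)"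
      unfolding l_def using r rshift by (intro tendsto_intros) auto
    ultimately have "(\<lambda>k. sk p \<delta> k / l k) \<longlonglongrightarrow> a / - ln (1 - r)"
      unfolding a_def by (intro tendsto_divide sk_tendsto rlim)
    then show ?thesis using False by (simp add: \<kappa>_def)
  qed
  have L_top: "filterlim L at_top sequentially"
  proof -
    have "filterlim (\<lambda>m. ytail p (m + \<delta>)) (at_right 0) sequentially"
      using LIMSEQ_ignore_initial_segment[OF ytail_tendsto_0] ytail_pos ytail_pos[THEN less_imp_neq, THEN not_sym]
      by (simp add: filterlim_at)
    then have "filterlim (\<lambda>m. - ln (ytail p (m + \<delta>))) at_top sequentially"
      by (intro filterlim_compose[OF filterlim_uminus_at_top_at_bot]
          filterlim_compose[OF ln_at_0])
    then have "filterlim (\<lambda>m. ln (yprev p \<delta>) + - ln (ytail p (m + \<delta>))) at_top sequentially"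
      by (rule filterlim_tendsto_add_at_top[OF tendsto_const])
    then show ?thesis by (simp add: L_eq[abs_def])
  qed
  note theta = theta_tendsto[of l, OF l L_top[unfolded L_def] ratio, folded L_def]
  have ln_top: "filterlim (\<lambda>n. ln (real n)) at_top sequentially"
    by (rule filterlim_compose[OF ln_at_top filterlim_real_sequentially])
  have "(\<lambda>n. L (mt p n) / ln n) \<longlonglongrightarrow> 1"
  proof -
    have "(\<lambda>k. - ln (1 - rk p k)) \<longlonglongrightarrow> - ln (1 - r)"
      using rlim r by (intro tendsto_intros) auto
    then have "convergent (\<lambda>k. - ln (1 - rk p k))" by (rule convergentI)
    then have "Bseq (\<lambda>k. - ln (1 - rk p k))" by (rule convergent_imp_Bseq)
    then obtain Q where Q: "0 < Q" "\<And>k. \<bar>ln (1 - rk p k)\<bar> \<le> Q" by (auto simp: Bseq_def)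
    \<comment> \<open>Since \<open>r < 1\<close>, a single step lowers the logarithm of the tail by
      at most \<open>Q\<close>. The \<open>1 + \<delta>\<close> steps from
      \<open>yprev p (mt p n)\<close> to \<open>ytail p (mt p n + \<delta>)\<close> cost
      \<open>(1 + \<delta>) * Q\<close>, and the last summand is the fixed starting value of the
      telescoping sum.\<close>
    define Q' where "Q' = (1 + \<delta>) * Q + \<bar>ln (yprev p \<delta>)\<bar>"
    have close: "\<bar>L (mt p n) - ln n\<bar> \<le> Q'" if n: "n \<ge> 1" for n :: nat
    proof -
      have lower: "ln n \<le> - ln (ytail p (mt p n + \<delta>))"
      proof -
        have "ytail p (mt p n + \<delta>) \<le> ytail p (mt p n)" by (intro ytail_antimono) simp
        also have "\<dots> < 1 / n" using n by (intro ytail_mt) simp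
        finally have "ln (ytail p (mt p n + \<delta>)) \<le> ln (1 / n)"
          using ytail_pos by (intro ln_mono) auto
        then show ?thesis using n by (simp add: ln_div)
      qed
      have "ln (yprev p (mt p n)) - ln (ytail p (\<delta> + mt p n)) = (\<Sum>k\<le>\<delta>. - ln (1 - rk p (k + mt p n)))"
        by (simp only: sum_minus_ln)
      also have "\<dots> \<le> (\<Sum>k\<le>\<delta>. Q)"
        using Q by (intro sum_mono) (auto simp: abs_le_iff)
      finally have "ln (yprev p (mt p n)) - ln (ytail p (mt p n + \<delta>)) \<le> (1 + \<delta>) * Q"
        by (simp add: add.commute)
      moreover have "- ln n \<le> ln (yprev p (mt p n))"
      proof -
        have "ln (1 / n) \<le> ln (yprev p (mt p n))" using n by (intro ln_mono yprev_mt) auto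
        then show ?thesis using n by (simp add: ln_div)
      qed
      ultimately have "- ln (ytail p (mt p n + \<delta>)) \<le> ln n + (1 + \<delta>) * Q" by linarith
      moreover have "0 \<le> (1 + \<delta>) * Q" using Q by simp
      ultimately show ?thesis using lower unfolding L_eq Q'_def by linarith
    qed
    have "(\<lambda>n. (L (mt p n) - ln n) / ln n) \<longlonglongrightarrow> 0"
    proof (rule Lim_null_comparison)
      show "(\<lambda>n. Q' / ln (real n)) \<longlonglongrightarrow> 0"
        by (rule real_tendsto_divide_at_top[OF tendsto_const ln_top])
      show "\<forall>\<^sub>F n in sequentially. norm ((L (mt p n) - ln n) / ln n) \<le> Q' / ln n"
        using eventually_ge_at_top[of 1]
        by eventually_elim (simp add: close abs_divide divide_right_mono)
    qed
    from tendsto_add[OF this tendsto_const[of 1]] have "(\<lambda>n. (L (mt p n) - ln n) / ln n + 1) \<longlonglongrightarrow> 1"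
      by simp
    moreover have "\<forall>\<^sub>F n in sequentially. (L (mt p n) - ln n) / ln n + 1 = L (mt p n) / ln n"
      using eventually_gt_at_top[of 1] by eventually_elim (simp add: field_simps)
    ultimately show ?thesis by (rule Lim_transform_eventually)
  qed
  from tendsto_mult[OF filterlim_compose[OF theta(1) mt_at_top] this]
  have "(\<lambda>n. theta p \<delta> (mt p n) / L (mt p n) * (L (mt p n) / ln n)) \<longlonglongrightarrow> \<kappa>" by simp
  moreover have "\<forall>\<^sub>F n in sequentially. theta p \<delta> (mt p (real n)) / L (mt p (real n)) * (L (mt p (real n)) / ln (real n))
      = theta p \<delta> (mt p (real n)) / (sqrt (ln (real n)))\<^sup>2"
    using eventually_ge_at_top[of 1]
  proof eventually_elim
    case (elim n)
    have "0 < L (mt p (real n))" unfolding L_def by (intro sum_pos l) auto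
    then show ?case using elim by simp
  qed
  ultimately have lim: "(\<lambda>n. theta p \<delta> (mt p (real n)) / (sqrt (ln (real n)))\<^sup>2) \<longlonglongrightarrow> \<kappa>"
    by (rule Lim_transform_eventually)
  \<comment> \<open>The first two terms in the bracket of \<open>sigma_sq\<close> combine to
    \<open>- (2 * \<delta> + 1) * r * (1 - r) ^ \<delta>\<close>, which exhibits the mean factor
    \<open>\<kappa>\<close> and the variance factor separately.\<close>
  have sq: "sigma_sq r \<delta> = \<kappa> * (1 - (2 * real \<delta> + 1) * (r * (1 - r) ^ \<delta>))"
    by (simp add: sigma_sq_def \<kappa>_def a_def algebra_simps add_divide_distrib diff_divide_distrib)
  then have "0 < sigma_sq r \<delta>"
    using \<kappa> limit_variance_factor_pos[OF r, of \<delta>] by simp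
  with sq lim theta(2)[OF \<kappa>] rlim show ?thesis
    by (intro Nrec_weak_conv[of r _ \<kappa>]) (auto intro!: filterlim_compose[OF sqrt_at_top ln_top])
qed

text \<open>Here \<open>sk p \<delta> k / ek p \<delta> k = rk p (k + \<delta>)\<close> tends to 1,
  so \<open>theta\<close> is asymptotic to the sum of the \<open>ek\<close>. Because
  \<open>\<delta>\<close> is positive, \<open>(1 - r) ^ \<delta>\<close> vanishes at
  \<open>r = 1\<close>, and the variance factor is 1.\<close>

lemma clt_of_rlim_1:
  assumes rlim: "rk p \<longlonglongrightarrow> 1" and \<delta>: "0 < \<delta>" and div: "\<not> summable (ek p \<delta>)"
  shows "weak_conv_m (\<lambda>n. distr M borel
      (\<lambda>\<omega>. (real (Nrec X \<delta> n \<omega>) - theta p \<delta> (mt p (real n))) / sqrt (\<Sum>k\<le>mt p (real n). ek p \<delta> k)))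
    std_normal_distribution"
proof -
  define L where "L m = (\<Sum>k\<le>m. ek p \<delta> k)" for m
  have L_top: "filterlim L at_top sequentially"
  proof -
    have mono: "incseq L" unfolding L_def by (intro incseq_SucI) (simp add: ek_pos less_imp_le)
    have "\<not> convergent L"
      using div by (simp add: L_def[abs_def] summable_iff_convergent')
    then have "\<exists>N. Z \<le> L N" for Z
      by (meson convergent_def incseq_convergent linear mono)
    then show ?thesis
      unfolding filterlim_at_top eventually_sequentially using mono by (meson incseqD order_trans)
  qed
  have "(\<lambda>k. rk p (k + \<delta>)) \<longlonglongrightarrow> 1" using rlim by (rule LIMSEQ_ignore_initial_segment)
  then have "(\<lambda>k. sk p \<delta> k / ek p \<delta> k) \<longlonglongrightarrow> 1"
    using ek_pos by (simp add: sk_eq less_imp_neq[THEN not_sym])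
  note theta = theta_tendsto[of "ek p \<delta>", OF ek_pos L_top[unfolded L_def] this, folded L_def]
  have "L m \<ge> 0" for m unfolding L_def by (intro sum_nonneg) (simp add: ek_pos less_imp_le)
  then have lim: "(\<lambda>n. theta p \<delta> (mt p n) / (sqrt (L (mt p n)))\<^sup>2) \<longlonglongrightarrow> 1"
    using filterlim_compose[OF theta(1) mt_at_top] by simp
  have "filterlim (\<lambda>n. sqrt (L (mt p (real n)))) at_top sequentially"
    by (intro filterlim_compose[OF sqrt_at_top] filterlim_compose[OF L_top] mt_at_top)
  from Nrec_weak_conv[OF rlim this theta(2) lim, of 1] \<delta> show ?thesis
    by (simp add: normal_dist_def L_def power_0_left)
qed

text \<open>As \<open>Nrec\<close> is nondecreasing in \<open>n\<close>, boundedness along a path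
  expresses that its limit is finite. The record probabilities \<open>sk\<close> are dominated by
  the summable \<open>ek\<close>.\<close>

lemma Nrec_bounded_of_summable:
  assumes "summable (ek p \<delta>)"
  shows "AE \<omega> in M. \<exists>B. \<forall>n. Nrec X \<delta> n \<omega> \<le> B"
proof -
  have "summable (\<lambda>i. sk p \<delta> (Suc i))"
  proof (rule summable_comparison_test')
    show "summable (\<lambda>i. ek p \<delta> (Suc i))" using assms by (simp add: summable_Suc_iff)
    show "norm (sk p \<delta> (Suc i)) \<le> ek p \<delta> (Suc i)" for i
      using sk_pos[of \<delta> "Suc i"] sk_le_ek[of \<delta> "Suc i"] by simp
  qed
  then have "AE \<omega> in M. \<forall>\<^sub>F i in sequentially. \<omega> \<in> space M - {\<omega> \<in> space M. Suc (i + \<delta>) \<in> record_values X \<delta> \<omega>}"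
    by (intro borel_cantelli_AE1) (simp_all add: prob_record emeasure_eq_measure)
  then show ?thesis
  proof (rule AE_mp, intro AE_I2 impI)
    fix \<omega> assume "\<omega> \<in> space M" and
      "\<forall>\<^sub>F i in sequentially. \<omega> \<in> space M - {\<omega> \<in> space M. Suc (i + \<delta>) \<in> record_values X \<delta> \<omega>}"
    then obtain K where K: "\<And>i. i \<ge> K \<Longrightarrow> Suc (i + \<delta>) \<notin> record_values X \<delta> \<omega>"
      by (auto simp: eventually_sequentially)
    have "record_values X \<delta> \<omega> \<subseteq> {..K + \<delta>}"
    proof (rule subsetI, rule ccontr)
      fix v assume "v \<in> record_values X \<delta> \<omega>" "v \<notin> {..K + \<delta>}"
      moreover from this have "K \<le> v - Suc \<delta>" "Suc (v - Suc \<delta> + \<delta>) = v" by auto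
      ultimately show False using K[of "v - Suc \<delta>"] by simp
    qed
    then have "finite (record_values X \<delta> \<omega>)" by (rule finite_subset) simp
    then have "Nrec X \<delta> n \<omega> \<le> card (record_values X \<delta> \<omega>)" for n
      unfolding Nrec_eq_Drec Drec_def by (intro card_mono) auto
    then show "\<exists>B. \<forall>n. Nrec X \<delta> n \<omega> \<le> B" by blast
  qed
qed

end

theorem theorem4p1:
  fixes M :: "'a measure" and X :: "nat \<Rightarrow> 'a \<Rightarrow> nat"
    and p :: "nat \<Rightarrow> real" and \<delta> :: nat and r :: real
  assumes "prob_space M"
    and indep: "prob_space.indep_vars M (\<lambda>_. count_space UNIV) X {1..}"
    and distr: "\<And>i k. i \<ge> 1 \<Longrightarrow> measure M {\<omega> \<in> space M. X i \<omega> = k} = p k"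
    and ppos: "\<And>k. p k > 0"
    and delta_pos: "\<delta> > 0"
    and rlim: "rk p \<longlonglongrightarrow> r"
    and r_range: "0 \<le> r" "r \<le> 1"
  shows "(r < 1 \<longrightarrow>
           weak_conv_m
             (\<lambda>n. distr M borel
                (\<lambda>\<omega>. (real (Nrec X \<delta> n \<omega>) - theta p \<delta> (mt p (real n))) / sqrt (ln (real n))))
             (normal_dist (sigma_sq r \<delta>)))
       \<and> (r = 1 \<longrightarrow>
           (\<not> summable (ek p \<delta>) \<longrightarrow>
              weak_conv_m
                (\<lambda>n. distr M borel
                   (\<lambda>\<omega>. (real (Nrec X \<delta> n \<omega>) - theta p \<delta> (mt p (real n)))
                          / sqrt (\<Sum>k\<le>mt p (real n). ek p \<delta> k)))
                std_normal_distribution)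
         \<and> (summable (ek p \<delta>) \<longrightarrow>
              (AE \<omega> in M. \<exists>B. \<forall>n. Nrec X \<delta> n \<omega> \<le> B)))"
proof -
  interpret prob_space M by fact
  interpret record_model M X p \<delta>
    by unfold_locales (fact indep distr ppos)+
  show ?thesis
    using clt_of_rlim_less_1[OF rlim r_range(1)] clt_of_rlim_1[OF _ delta_pos] Nrec_bounded_of_summable rlim
    by blast
qed

end
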